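(* Let $G$ be a finite abelian group of order $N$ and let $S\subseteq G\setminus\{0\}$ satisfy $S=-S$. Let $\mathcal{O}$ be a Galois orbit over $\mathbb{Q}$ of the eigenvalue set $\{\lambda_\chi:\chi\in\widehat{G}\}$, let $\lambda_{\mathcal{O}}=\lambda_\chi\in\mathcal{O}$ be a representative (with $\chi\in\widehat{G}$), and let $L_{\mathcal{O}}=\mathbb{Q}(\lambda_{\mathcal{O}})$. Then $L_{\mathcal{O}}/\mathbb{Q}$ is Galois with group $$\mathrm{Gal}(L_{\mathcal{O}}/\mathbb{Q})\cong(\mathbb{Z}/N\mathbb{Z})^*\big/\mathrm{Stab}(\lambda_{\mathcal{O}}),\qquad \mathrm{Stab}(\lambda_{\mathcal{O}})=\{a\in(\mathbb{Z}/N\mathbb{Z})^*:\lambda_{\chi^a}=\lambda_\chi\}.$$ Moreover $-1\in\mathrm{Stab}(\lambda_{\mathcal{O}})$ always holds, so $\langle-1\rangle\subseteq\mathrm{Stab}(\lambda_{\mathcal{O}})$, and equivalently $$\mathrm{Gal}(L_{\mathcal{O}}/\mathbb{Q})\cong\bigl[(\mathbb{Z}/N\mathbb{Z})^*/\langle-1\rangle\bigr]\big/\bigl[\mathrm{Stab}(\lambda_{\mathcal{O}})/\langle-1\rangle\bigr].$$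
   Context: $G$ is written additively, $\widehat{G}=\mathrm{Hom}(G,\mathbb{C}^* )$, $\lambda_\chi=\sum_{s\in S}\chi(s)$ for $\chi\in\widehat{G}$ (these are the eigenvalues of the adjacency matrix of the Cayley graph $\mathrm{Cay}(G,S)$, with vertex set $G$ and edges $\{g,g+s\}$, $s\in S$), and $\chi^a(g)=\chi(g)^a$ for $a\in(\mathbb{Z}/N\mathbb{Z})^*$. Galois orbits over $\mathbb{Q}$ are orbits under $\mathrm{Gal}(\overline{\mathbb{Q}}/\mathbb{Q})$. The fields $L_{\mathcal{O}}$ are the simple factors of the spectral algebra $\mathbb{Q}[A]$, $A$ being the adjacency matrix. *)

theory Defs
  imports
    Complex_Main
    "HOL-Algebra.Algebraic_Closure_Type"
    "HOL-Algebra.Group_Action"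
    "HOL-Algebra.Generated_Fields"
    "HOL-Number_Theory.Residues"
begin

abbreviation complex_ring :: "complex ring" where
  "complex_ring \<equiv> ring_of_type_algebra"


subsection \<open>Subfields of the complex numbers and their Galois theory\<close>

definition adjoin :: "complex set \<Rightarrow> complex \<Rightarrow> complex set" where
  "adjoin K x = generate_field complex_ring (insert x K)"

definition splits_over :: "complex set \<Rightarrow> complex poly \<Rightarrow> bool" where
  "splits_over L p \<longleftrightarrow>
     (\<exists>c\<in>L. \<exists>xs. set xs \<subseteq> L \<and> p = smult c (\<Prod>x\<leftarrow>xs. [:- x, 1:]))"

text \<open>
  A subfield of the complex numbers is Galois over the rationals if it is algebraic, normal and
  separable over them.  In the last two clauses every irreducible rational polynomial with a root
  in \<open>L\<close> occurs, not only the monic ones (the minimal polynomials); the scalar \<open>c\<close>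
  in \<^const>\<open>splits_over\<close> takes care of the leading coefficient.
\<close>

definition galois_over_rat :: "complex set \<Rightarrow> bool" where
  "galois_over_rat L \<longleftrightarrow>
     subfield L complex_ring \<and>
     (\<forall>x\<in>L. Polynomial.algebraic x) \<and>
     (\<forall>p :: rat poly. Factorial_Ring.irreducible p \<longrightarrow>
        (\<exists>x\<in>L. poly (map_poly of_rat p) x = 0) \<longrightarrow> splits_over L (map_poly of_rat p)) \<and>
     (\<forall>p :: rat poly. Factorial_Ring.irreducible p \<longrightarrow>
        (\<exists>x\<in>L. poly (map_poly of_rat p) x = 0) \<longrightarrow>
        rsquarefree (map_poly of_rat p :: complex poly))"

text \<open>
  The field automorphisms of \<open>L\<close> fixing \<open>K\<close> pointwise, under composition; as elements of
  \<^const>\<open>BijGroup\<close> they are extensional functions, so each automorphism is counted once.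
\<close>

definition gal_group :: "complex set \<Rightarrow> complex set \<Rightarrow> (complex \<Rightarrow> complex) monoid" where
  "gal_group K L = BijGroup L
     \<lparr>carrier := {\<sigma> \<in> Bij L.
        \<sigma> \<in> ring_hom (complex_ring\<lparr>carrier := L\<rparr>) (complex_ring\<lparr>carrier := L\<rparr>) \<and>
        (\<forall>x\<in>K. \<sigma> x = x)}\<rparr>"

definition rat_closure :: "complex set" where
  "rat_closure = {z. Polynomial.algebraic z}"

definition galois_orbits :: "complex set \<Rightarrow> complex set set" where
  "galois_orbits E = orbits (gal_group \<rat> rat_closure) E (\<lambda>\<sigma>. \<sigma>)"


subsection \<open>The unit group modulo \<open>N\<close>\<close>

text \<open>
  \<^const>\<open>residue_ring\<close> has the integer 1 as its unit even for modulus 1, where the carrier is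
  \<open>{0}\<close>; the update repairs that case and changes nothing for \<open>N > 1\<close>.
\<close>

definition unit_group :: "nat \<Rightarrow> int monoid" where
  "unit_group N = units_of (residue_ring (int N) \<lparr>one := 1 mod int N\<rparr>)"


subsection \<open>Characters and Cayley graph eigenvalues\<close>

text \<open>
  The abelian group \<open>G\<close> is written multiplicatively, following the library.  Characters are
  determined only on the carrier of \<open>G\<close>; their values elsewhere play no role below.
\<close>

definition characters :: "('g, 'b) monoid_scheme \<Rightarrow> ('g \<Rightarrow> complex) set" where
  "characters G = hom G (units_of complex_ring)"

definition cayley_eigenvalue :: "'g set \<Rightarrow> ('g \<Rightarrow> complex) \<Rightarrow> complex" where
  "cayley_eigenvalue S \<chi> = (\<Sum>s\<in>S. \<chi> s)"

definition char_pow :: "('g \<Rightarrow> complex) \<Rightarrow> int \<Rightarrow> 'g \<Rightarrow> complex" where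
  "char_pow \<chi> a = (\<lambda>g. \<chi> g powi a)"

definition eigenvalue_stab :: "nat \<Rightarrow> 'g set \<Rightarrow> ('g \<Rightarrow> complex) \<Rightarrow> int set" where
  "eigenvalue_stab N S \<chi> =
     {a \<in> carrier (unit_group N).
        cayley_eigenvalue S (char_pow \<chi> a) = cayley_eigenvalue S \<chi>}"

end

theory Submission
  imports Defs "HOL-Computational_Algebra.Computational_Algebra"
begin

text \<open>
  Every character value is a power of \<open>\<zeta> = exp (2 \<pi> i / N)\<close>, so \<open>\<lambda>\<^sub>\<chi> = f(\<zeta>)\<close> and
  \<open>\<lambda>\<close> at \<open>\<chi>\<^sup>a\<close> equals \<open>f(\<zeta>\<^sup>a)\<close> for one rational polynomial \<open>f\<close>.  The arithmetic input
  is Dedekind's theorem that a rational polynomial vanishing at \<open>\<zeta>\<close> vanishes at \<open>\<zeta>\<^sup>a\<close> for \<open>a\<close>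
  coprime to \<open>N\<close>; hence \<open>g(\<zeta>) \<mapsto> g(\<zeta>\<^sup>a)\<close> is well defined, and the trace
  \<open>\<Sum>\<^sub>a h(\<zeta>\<^sup>a)\<close> is rational.

  Galois theory is replaced by interpolation.  If \<open>p\<close> is a rational polynomial vanishing at all
  \<open>y\<^sub>a = f(\<zeta>\<^sup>a)\<close>, then \<open>T(x) = \<Sum>\<^sub>a h(\<zeta>\<^sup>a) (p(x) - p(y\<^sub>a)) / (x - y\<^sub>a)\<close> has rational coefficients,
  being a combination of traces, and at a root \<open>x\<close> of \<open>p\<close> its value is \<open>p'(x)\<close> times the sum of
  those \<open>h(\<zeta>\<^sup>a)\<close> with \<open>y\<^sub>a = x\<close>.  Taking \<open>h = 1\<close> shows that an irreducible \<open>p\<close> has no other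
  roots than the \<open>y\<^sub>a\<close>; taking \<open>h\<close> invariant under the stabiliser of \<open>f(\<zeta>)\<close> shows that \<open>h(\<zeta>)\<close> lies
  in \<open>\<rat>(f(\<zeta>))\<close>.  As \<open>(\<int>/N\<int>)*\<close> is abelian, this applies to the conjugates of \<open>f(\<zeta>)\<close>, so the field is
  normal and the units modulo \<open>N\<close> act on it, with the stabiliser as kernel.
\<close>

subsection \<open>Ring homomorphisms and polynomials\<close>

text \<open>Both coefficient embeddings, \<open>of_int\<close> and \<open>of_rat\<close>, are
  instances, so the rules for \<open>map_poly\<close> and the root lemma below serve integer and
  rational polynomials alike.\<close>

locale comm_ring_hom_1 =
  fixes h :: "'a::idom \<Rightarrow> 'b::idom"
  assumes hom_add: "h (x + y) = h x + h y"
    and hom_mult: "h (x * y) = h x * h y"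
    and hom_one: "h 1 = 1"
begin

lemma hom_zero: "h 0 = 0"
  using hom_add[of 0 0] by (metis add.right_neutral add_left_cancel)

lemma hom_uminus: "h (- x) = - h x"
  using hom_add[of x "- x"] hom_zero by (simp add: eq_neg_iff_add_eq_0 add.commute)

lemma map_poly_add: "map_poly h (p + q) = map_poly h p + map_poly h q"
  by (rule poly_eqI) (simp add: coeff_map_poly hom_zero hom_add)

lemma map_poly_uminus: "map_poly h (- p) = - map_poly h p"
  by (rule poly_eqI) (simp add: coeff_map_poly hom_zero hom_uminus)

lemma map_poly_diff: "map_poly h (p - q) = map_poly h p - map_poly h q"
  using map_poly_add[of p "- q"] by (simp add: map_poly_uminus)

lemma map_poly_smult: "map_poly h (smult c p) = smult (h c) (map_poly h p)"
  by (rule poly_eqI) (simp add: coeff_map_poly hom_zero hom_mult)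

lemma map_poly_pCons: "map_poly h (pCons a p) = pCons (h a) (map_poly h p)"
  by (rule Polynomial.map_poly_pCons) (simp add: hom_zero)

lemma map_poly_mult: "map_poly h (p * q) = map_poly h p * map_poly h q"
proof (induction p)
  case (pCons a p)
  then show ?case
    by (simp add: map_poly_add map_poly_smult map_poly_pCons hom_zero)
qed simp

lemma map_poly_one: "map_poly h 1 = 1"
  by (rule map_poly_1') (rule hom_one)

lemma map_poly_power: "map_poly h (p ^ n) = map_poly h p ^ n"
  by (induction n) (simp_all add: map_poly_mult map_poly_one)

lemma map_poly_sum: "map_poly h (\<Sum>i\<in>I. f i) = (\<Sum>i\<in>I. map_poly h (f i))"
  by (induction I rule: infinite_finite_induct) (simp_all add: map_poly_add)

lemma map_poly_prod: "map_poly h (\<Prod>i\<in>I. f i) = (\<Prod>i\<in>I. map_poly h (f i))"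
  by (induction I rule: infinite_finite_induct) (simp_all add: map_poly_mult map_poly_one)

lemma map_poly_monom: "map_poly h (monom a n) = monom (h a) n"
  by (rule Polynomial.map_poly_monom) (rule hom_zero)

lemma map_poly_pcompose: "map_poly h (p \<circ>\<^sub>p q) = map_poly h p \<circ>\<^sub>p map_poly h q"
  by (induction p) (simp_all add: pcompose_pCons map_poly_add map_poly_mult map_poly_pCons hom_zero)

lemma hom_of_nat: "h (of_nat n) = of_nat n"
  by (induction n) (simp_all add: hom_add hom_zero hom_one)

lemma map_poly_pderiv: "map_poly h (pderiv p) = pderiv (map_poly h p)"
  by (induction p) (simp_all add: pderiv_pCons map_poly_add map_poly_pCons hom_zero)

lemma map_poly_of_nat: "map_poly h (of_nat n) = of_nat n"
  by (simp add: of_nat_poly map_poly_pCons hom_of_nat)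

lemmas map_poly_hom =
  map_poly_add map_poly_uminus map_poly_diff map_poly_smult map_poly_pCons map_poly_mult
  map_poly_one map_poly_power map_poly_sum map_poly_prod map_poly_monom map_poly_pcompose
  map_poly_pderiv map_poly_of_nat

end

interpretation of_int_hom: comm_ring_hom_1 "of_int :: int \<Rightarrow> 'a::{idom,ring_char_0}"
  by standard simp_all

interpretation of_rat_hom: comm_ring_hom_1 "of_rat :: rat \<Rightarrow> 'a::field_char_0"
  by standard (simp_all add: of_rat_add of_rat_mult)

text \<open>Follows the prime factorisation: a unit is sent to a polynomial without roots, and in a
  domain a root of a product is a root of one of the factors.\<close>

lemma prime_factor_with_root:
  fixes h :: "'a::{factorial_ring_gcd,semiring_gcd_mult_normalize} \<Rightarrow> 'b::idom" and p :: "'a poly"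
  assumes "comm_ring_hom_1 h" "p \<noteq> 0" "poly (map_poly h p) x = 0"
  obtains q where "prime_elem q" "q dvd p" "poly (map_poly h q) x = 0"
proof -
  interpret comm_ring_hom_1 h by fact
  have "\<exists>q. prime_elem q \<and> q dvd p \<and> poly (map_poly h q) x = 0"
    using assms(2,3)
  proof (induction p rule: prime_divisors_induct)
    case (unit p)
    then obtain q where "p * q = 1" by (metis dvdE)
    then have "poly (map_poly h (p * q)) x = 1"
      by (simp add: map_poly_hom)
    with unit.prems show ?case by (simp add: map_poly_hom)
  next
    case (factor q p)
    then show ?case by (auto simp: map_poly_hom intro: dvd_mult)
  qed simp
  then show ?thesis using that by blast
qed

lemmas int_prime_factor_with_root = prime_factor_with_root[OF of_int_hom.comm_ring_hom_1_axioms]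
lemmas rat_prime_factor_with_root = prime_factor_with_root[OF of_rat_hom.comm_ring_hom_1_axioms]

subsection \<open>Rational relations between roots of unity\<close>

text \<open>The inner binomial coefficients are divisible by \<open>p\<close>. The explicit cofactor
  \<open>c\<close> replaces a congruence, so that the statement applies both to integers and to
  integer polynomials.\<close>

lemma add_power_prime:
  fixes a b :: "'a::comm_ring_1"
  assumes p: "prime p"
  shows "\<exists>c. (a + b) ^ p = a ^ p + b ^ p + of_nat p * c"
proof -
  have "\<exists>c. of_nat (p choose k) * a ^ k * b ^ (p - k) = of_nat p * c"
    if k: "k \<in> {1..<p}" for k
  proof -
    have "p dvd p choose k"
      by (rule dvd_choose_prime) (use k p in \<open>auto dest: prime_gt_1_nat\<close>)
    then show ?thesis
      by (auto simp: mult.assoc elim!: dvdE)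
  qed
  then obtain c where
    c: "\<And>k. k \<in> {1..<p} \<Longrightarrow> of_nat (p choose k) * a ^ k * b ^ (p - k) = of_nat p * c k"
    by metis
  have "{..p} = insert 0 (insert p {1..<p})"
    using prime_gt_0_nat[OF p] by auto
  then have "(a + b) ^ p = a ^ p + b ^ p + (\<Sum>k\<in>{1..<p}. of_nat (p choose k) * a ^ k * b ^ (p - k))"
    using prime_gt_0_nat[OF p] by (simp add: binomial_ring)
  also have "(\<Sum>k\<in>{1..<p}. of_nat (p choose k) * a ^ k * b ^ (p - k)) = of_nat p * sum c {1..<p}"
    by (simp add: c sum_distrib_left)
  finally show ?thesis by blast
qed

text \<open>Induction by means of \<open>add_power_prime\<close> gives the non-negative case; any
  other integer is replaced by its residue modulo \<open>p\<close>.\<close>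

lemma fermat_int:
  fixes a :: int
  assumes p: "prime p"
  shows "[a ^ p = a] (mod int p)"
proof -
  have nat: "[int n ^ p = int n] (mod int p)" for n
  proof (induction n)
    case 0
    then show ?case using prime_gt_0_nat[OF p] by (simp add: power_0_left)
  next
    case (Suc n)
    obtain c where c: "(int n + 1) ^ p = int n ^ p + 1 ^ p + of_nat p * c"
      using add_power_prime[OF p] by blast
    have "[int n ^ p + 1 + int p * c = int n + 1 + 0] (mod int p)"
      by (intro cong_add Suc.IH) (simp_all add: cong_def)
    then show ?case using c by (simp add: ac_simps)
  qed
  define n where "n = nat (a mod int p)"
  have "[a = int n] (mod int p)"
    using prime_gt_0_nat[OF p] by (simp add: n_def cong_def)
  then have "[a ^ p = int n ^ p] (mod int p)" "[int n = a] (mod int p)"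
    by (simp_all add: cong_pow cong_sym)
  then show ?thesis
    using nat cong_trans by blast
qed

text \<open>The Frobenius congruence: modulo \<open>p\<close>, raising to the power \<open>p\<close>
  is additive by \<open>add_power_prime\<close> and fixes the coefficients by
  \<open>fermat_int\<close>.\<close>

lemma pcompose_monom_prime:
  fixes f :: "int poly"
  assumes p: "prime p"
  shows "\<exists>g. f \<circ>\<^sub>p monom 1 p = f ^ p + of_nat p * g"
proof (induction f)
  case 0
  then show ?case using prime_gt_0_nat[OF p] by (intro exI[of _ 0]) simp
next
  case (pCons a f)
  then obtain g where g: "f \<circ>\<^sub>p monom 1 p = f ^ p + of_nat p * g" by blast
  obtain d where d: "a = a ^ p + int p * d"
    using fermat_int[OF p, of a] by (metis cong_iff_lin cong_sym)
  obtain c where c: "([:a:] + monom 1 1 * f) ^ p = [:a:] ^ p + (monom 1 1 * f) ^ p + of_nat p * c"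
    using add_power_prime[OF p] by blast
  have 1: "pCons a f = [:a:] + monom 1 1 * f"
    by (simp add: monom_Suc monom_0)
  have 2: "[:a:] = [:a:] ^ p + of_nat p * [:d:]"
    using d by (simp add: of_nat_poly poly_const_pow mult.commute)
  have "pCons a f \<circ>\<^sub>p monom 1 p = [:a:] + monom 1 p * (f ^ p + of_nat p * g)"
    by (simp add: pcompose_pCons g)
  also have "\<dots> = [:a:] ^ p + of_nat p * [:d:] + monom 1 p * (f ^ p + of_nat p * g)"
    using 2 by simp
  also have "\<dots> = pCons a f ^ p + of_nat p * ([:d:] + monom 1 p * g - c)"
    unfolding 1 c by (simp add: algebra_simps power_mult_distrib monom_power)
  finally show ?case by blast
qed

text \<open>Pseudo-division scales \<open>f\<close> by a power of the leading coefficient of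
  \<open>m\<close>; this power is a unit here, so the scaling can be undone.\<close>

lemma int_poly_division:
  fixes f m :: "int poly"
  assumes "lead_coeff m dvd 1"
  obtains q r where "f = m * q + r" "r = 0 \<or> degree r < degree m"
proof -
  obtain q r where qr: "pseudo_divmod f m = (q, r)" by fastforce
  define c where "c = lead_coeff m ^ (Suc (degree f) - degree m)"
  have m: "m \<noteq> 0" using assms by auto
  have 1: "smult c f = m * q + r" and 2: "r = 0 \<or> degree r < degree m"
    using pseudo_divmod[OF m qr] by (simp_all add: c_def)
  have "c dvd 1"
    unfolding c_def using assms dvd_power_same[of "lead_coeff m" 1] by simp
  then obtain d where d: "d * c = 1"
    by (metis dvdE mult.commute)
  have "f = smult d (smult c f)" using d by simp
  also have "\<dots> = m * smult d q + smult d r"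
    by (simp add: 1 smult_add_right)
  finally show ?thesis
    using that[of "smult d q" "smult d r"] 2 by (auto simp: order.strict_trans1[OF degree_smult_le])
qed

text \<open>Makes a prime polynomial act as a minimal polynomial. Let \<open>k\<close> have least
  degree among the nonzero polynomials vanishing at \<open>x\<close>. The pseudo-remainder of
  \<open>m\<close> by \<open>k\<close> also vanishes at \<open>x\<close>, hence is zero, and
  \<open>m\<close> divides \<open>k * q\<close>. If \<open>m\<close> divided \<open>q\<close>, then
  \<open>k\<close> would be a nonzero constant, which has no root.\<close>

lemma degree_prime_le_of_common_root:
  fixes m g :: "int poly" and x :: "'a::{idom,ring_char_0}"
  assumes m: "prime_elem m" "poly (map_poly of_int m) x = 0"
    and g: "g \<noteq> 0" "poly (map_poly of_int g) x = 0"
  shows "degree m \<le> degree g"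
proof -
  let ?V = "\<lambda>g. g \<noteq> 0 \<and> poly (map_poly of_int g) x = 0"
  obtain k where k: "?V k" and least: "\<And>g. ?V g \<Longrightarrow> degree k \<le> degree g"
    using ex_has_least_nat[of ?V g degree] g by auto
  obtain c q where c: "c \<noteq> 0" "smult c m = k * q + pseudo_mod m k"
    using pseudo_mod(1)[of k m] k by blast
  have "poly (map_poly of_int (pseudo_mod m k)) x = 0"
  proof -
    have "pseudo_mod m k = smult c m - k * q" using c by simp
    then show ?thesis using m k by (simp add: of_int_hom.map_poly_hom)
  qed
  then have "pseudo_mod m k = 0"
    using pseudo_mod(2)[of k m] k least[of "pseudo_mod m k"] by fastforce
  with c have eq: "smult c m = k * q" by simp
  then have "m dvd k * q" by (metis dvd_smult dvd_refl)
  then have "m dvd k \<or> m dvd q" using m(1) prime_elem_dvd_mult_iff by blast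
  then have "m dvd k"
  proof
    assume "m dvd q"
    then obtain q' where "q = m * q'" by blast
    with eq have "m * [:c:] = m * (k * q')" by (simp add: mult_ac)
    then have kq: "[:c:] = k * q'" using m(1) by (metis mult_cancel_left prime_elem_not_zeroI)
    then have "degree k = 0"
      using c(1) by (metis degree_mult_eq degree_pCons_0 add_is_0 mult_eq_0_iff pCons_eq_0_iff)
    then obtain a where "k = [:a:]" by (elim degree_eq_zeroE)
    with k show ?thesis by (simp add: of_int_hom.map_poly_hom)
  qed
  then have "degree m \<le> degree k" using k by (intro dvd_imp_degree_le) auto
  also have "\<dots> \<le> degree g" using least g by blast
  finally show ?thesis .
qed

text \<open>
  If the prime factor \<open>m\<close> of \<open>x\<^sup>N - 1 = m h\<close> with \<open>m(w) = 0\<close> did not vanish at \<open>w\<^sup>p\<close>, then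
  \<open>h(w\<^sup>p) = 0\<close>, and differentiating gives \<open>N w\<^sup>-\<^sup>p = m(w\<^sup>p) h'(w\<^sup>p)\<close>.  But \<open>m(x\<^sup>p)\<close> is congruent
  to \<open>m(x)\<^sup>p\<close> modulo \<open>p\<close>, so \<open>p\<close> divides \<open>N\<close> in \<open>\<int>[w]\<close>, hence in \<open>\<int>\<close>.
\<close>

lemma int_poly_root_of_unity_power_prime:
  fixes f :: "int poly" and w :: "'a::field_char_0"
  assumes N: "N > 0" "w ^ N = 1" and p: "prime p" "\<not> p dvd N"
    and f: "poly (map_poly of_int f) w = 0"
  shows "poly (map_poly of_int f) (w ^ p) = 0"
proof -
  let ?e = "\<lambda>f x. poly (map_poly of_int f) (x :: 'a)"
  define P :: "int poly" where "P = monom 1 N - 1"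
  have P_eval: "?e P x = x ^ N - 1" for x
    by (simp add: P_def of_int_hom.map_poly_hom poly_monom)
  have "coeff P N = 1" using N by (simp add: P_def)
  moreover have "degree P \<le> N"
    by (auto simp: P_def intro: degree_diff_le degree_monom_le)
  ultimately have lead_P: "lead_coeff P = 1"
    by (metis le_degree le_antisym zero_neq_one)
  then have P: "P \<noteq> 0" by auto
  obtain m where m: "prime_elem m" "m dvd P" "?e m w = 0"
    using int_prime_factor_with_root[OF P, of w] N P_eval[of w] by auto
  obtain h where h: "P = m * h" using m(2) by blast
  have unit: "lead_coeff m dvd 1"
  proof -
    have "lead_coeff m * lead_coeff h = 1" using lead_P by (simp only: h lead_coeff_mult)
    then show ?thesis by (metis dvd_triv_left)
  qed
  have e_pcompose: "?e (g \<circ>\<^sub>p monom 1 p) w = ?e g (w ^ p)" for g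
    by (simp add: of_int_hom.map_poly_hom poly_pcompose poly_monom)
  have "?e m (w ^ p) = 0"
  proof (rule ccontr)
    assume nz: "?e m (w ^ p) \<noteq> 0"
    obtain g where g: "m \<circ>\<^sub>p monom 1 p = m ^ p + of_nat p * g"
      using pcompose_monom_prime[OF p(1)] by blast
    have m_pow: "?e m (w ^ p) = of_nat p * ?e g w"
      using p m by (simp add: g of_int_hom.map_poly_hom prime_gt_0_nat flip: e_pcompose)
    have wpN: "(w ^ p) ^ N = 1"
      using N(2) by (metis mult.commute power_mult power_one)
    then have "?e m (w ^ p) * ?e h (w ^ p) = 0"
      using P_eval[of "w ^ p"] by (simp add: h of_int_hom.map_poly_hom)
    with nz have h0: "?e h (w ^ p) = 0" by simp
    have "pderiv P = monom (of_nat N) (N - 1)"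
      by (simp add: P_def pderiv_diff pderiv_monom)
    then have "of_nat N * (w ^ p) ^ (N - 1) = ?e (pderiv P) (w ^ p)"
      by (simp add: of_int_hom.map_poly_hom poly_monom)
    also have "\<dots> = ?e m (w ^ p) * ?e (pderiv h) (w ^ p)"
      by (simp add: h pderiv_mult of_int_hom.map_poly_hom h0)
    finally have "of_nat N * ((w ^ p) ^ (N - 1) * w ^ p) =
        of_nat p * (?e g w * ?e (pderiv h) (w ^ p) * w ^ p)"
      by (simp add: m_pow)
    also have "(w ^ p) ^ (N - 1) * w ^ p = 1"
      using N(1) wpN by (metis power_minus_mult)
    finally have Nk: "of_nat N = of_nat p * ?e (g * (pderiv h \<circ>\<^sub>p monom 1 p) * monom 1 p) w"
      by (simp add: of_int_hom.map_poly_mult e_pcompose) (simp add: of_int_hom.map_poly_hom poly_monom)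
    \<comment> \<open>Passage from \<open>\<int>[w]\<close> to the integers: modulo \<open>m\<close>
      the cofactor of \<open>p\<close> is represented by some \<open>r\<close> of degree below that
      of \<open>m\<close>. Then \<open>of_nat N - of_nat p * r\<close> vanishes at \<open>w\<close>
      and has too small a degree, so it is the zero polynomial, and its constant coefficient shows
      that \<open>p\<close> divides \<open>N\<close>.\<close>
    obtain q r where qr: "g * (pderiv h \<circ>\<^sub>p monom 1 p) * monom 1 p = m * q + r"
      "r = 0 \<or> degree r < degree m"
      using int_poly_division[OF unit] by blast
    have "degree m \<noteq> 0"
    proof
      assume "degree m = 0"
      then obtain a where "m = [:a:]" by (elim degree_eq_zeroE)
      with m show False by (simp add: of_int_hom.map_poly_hom)
    qed
    have "?e (of_nat N - of_nat p * r) w = 0"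
      using Nk m(3) by (simp add: qr of_int_hom.map_poly_hom)
    moreover have "degree (of_nat N - of_nat p * r) < degree m"
    proof (rule degree_diff_less)
      show "degree (of_nat p * r) < degree m"
        using qr(2) \<open>degree m \<noteq> 0\<close> degree_mult_le[of "of_nat p" r] by auto
    qed (use \<open>degree m \<noteq> 0\<close> in simp)
    ultimately have "of_nat N - of_nat p * r = 0"
      using degree_prime_le_of_common_root[OF m(1,3)] by (meson not_less)
    then have "coeff (of_nat N - of_nat p * r) 0 = 0" by simp
    then have "int N = int p * coeff r 0"
      by (simp add: coeff_mult of_nat_poly)
    then have "int p dvd int N" by simp
    with p show False by simp
  qed
  \<comment> \<open>From \<open>m\<close> to the given \<open>f\<close>: the remainder of
    \<open>f\<close> modulo \<open>m\<close> vanishes at \<open>w\<close> and is zero for reasons of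
    degree, so \<open>m\<close> divides \<open>f\<close>.\<close>
  moreover obtain q r where qr: "f = m * q + r" "r = 0 \<or> degree r < degree m"
    using int_poly_division[OF unit] by blast
  moreover have "r = 0"
  proof (rule ccontr)
    assume "r \<noteq> 0"
    moreover have "?e r w = 0" using f m(3) by (simp add: qr of_int_hom.map_poly_hom)
    ultimately show False
      using degree_prime_le_of_common_root[OF m(1,3), of r] qr(2) by simp
  qed
  ultimately show ?thesis by (simp add: of_int_hom.map_poly_hom)
qed

lemma rat_poly_clear_denominators:
  fixes f :: "rat poly"
  shows "\<exists>c g. c \<noteq> 0 \<and> smult (of_int c) f = map_poly of_int g"
proof (induction f)
  case 0
  show ?case by (intro exI[of _ 1] exI[of _ 0]) simp
next
  case (pCons a f)
  then obtain c g where cg: "c \<noteq> 0" "smult (of_int c) f = map_poly of_int g" by blast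
  obtain u v where uv: "v > 0" "a = of_int u / of_int v"
    by (metis quotient_of_div quotient_of_denom_pos surj_pair)
  have "smult (of_int (v * c)) (pCons a f) = map_poly of_int (pCons (u * c) (smult v g))"
    using uv cg(2) by (simp add: of_int_hom.map_poly_hom flip: cg(2))
  with uv cg show ?case
    by (intro exI[of _ "v * c"] exI[of _ "pCons (u * c) (smult v g)"]) auto
qed

text \<open>Denominators are cleared, and the exponent \<open>a\<close> is built up from its prime
  factors. The root \<open>w\<close> is kept arbitrary because each prime \<open>p\<close> replaces
  it by \<open>w ^ p\<close>, again a root of unity of order dividing \<open>N\<close>.\<close>

lemma rat_poly_root_of_unity_power:
  fixes f :: "rat poly" and w :: "'a::field_char_0"
  assumes "N > 0" "w ^ N = 1" "coprime a N" "poly (map_poly of_rat f) w = 0"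
  shows "poly (map_poly of_rat f) (w ^ a) = 0"
proof -
  obtain c g where cg: "c \<noteq> 0" "smult (of_int c) f = map_poly of_int g"
    using rat_poly_clear_denominators by blast
  have eval: "poly (map_poly of_int g) x = of_int c * poly (map_poly of_rat f) x" for x :: 'a
  proof -
    have "map_poly (of_int :: int \<Rightarrow> 'a) g = map_poly of_rat (map_poly of_int g)"
      by (simp add: map_poly_map_poly o_def)
    then show ?thesis by (simp add: of_rat_hom.map_poly_hom flip: cg(2))
  qed
  have "poly (map_poly of_int g) (w ^ a) = 0"
    using assms(3,2,4)
  proof (induction a arbitrary: w rule: prime_divisors_induct)
    \<comment> \<open>Here \<open>N = 1\<close>, since \<open>0\<close> is coprime to
      \<open>N\<close>; thus \<open>w = 1 = w ^ 0\<close>.\<close>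
    case zero
    then show ?case by (simp add: eval)
  next
    case (unit a)
    then show ?case by (simp add: eval)
  next
    case (factor p a)
    then have *: "coprime p N" "coprime a N" "w ^ N = 1" "poly (map_poly of_int g) w = 0"
      by (simp_all add: eval)
    have "\<not> p dvd N"
      using *(1) factor.hyps by (metis coprime_absorb_left not_prime_unit)
    then have "poly (map_poly of_int g) (w ^ p) = 0"
      using int_poly_root_of_unity_power_prime assms(1) * factor.hyps by blast
    moreover have "(w ^ p) ^ N = 1"
      using *(3) by (metis mult.commute power_mult power_one)
    ultimately show ?case
      using factor.IH[of "w ^ p"] * cg(1) by (simp add: eval power_mult)
  qed
  then show ?thesis using cg(1) by (simp add: eval)
qed

subsection \<open>Irreducible rational polynomials\<close>

text \<open>Otherwise \<open>p\<close> and \<open>q\<close> would be coprime, and a Bezout identity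
  evaluated at \<open>x\<close> would read \<open>0 = 1\<close>.\<close>

lemma irreducible_rat_poly_dvd:
  fixes p q :: "rat poly" and x :: "'a::field_char_0"
  assumes "Factorial_Ring.irreducible p"
    "poly (map_poly of_rat p) x = 0" "poly (map_poly of_rat q) x = 0"
  shows "p dvd q"
proof (rule ccontr)
  assume "\<not> p dvd q"
  then have "coprime p q"
    using assms(1) by (intro prime_elem_imp_coprime irreducible_imp_prime_elem)
  then have "fst (bezout_coefficients p q) * p + snd (bezout_coefficients p q) * q = 1"
    by (simp add: bezout_coefficients_fst_snd)
  then have "poly (map_poly of_rat (fst (bezout_coefficients p q) * p +
      snd (bezout_coefficients p q) * q)) x = 1"
    by (simp add: of_rat_hom.map_poly_hom)
  with assms(2,3) show False by (simp add: of_rat_hom.map_poly_hom)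
qed

lemma irreducible_rat_poly_degree:
  fixes p :: "rat poly"
  assumes "Factorial_Ring.irreducible p"
  shows "degree p > 0"
proof (rule ccontr)
  assume "\<not> degree p > 0"
  then obtain a where "p = [:a:]" by (auto elim: degree_eq_zeroE)
  with assms show False
    using Factorial_Ring.irreducible_not_unit[of p]
    by (cases "a = 0") (auto simp: is_unit_const_poly_iff dvd_field_iff)
qed

text \<open>Otherwise \<open>p\<close> would divide its derivative, which has smaller degree and is
  nonzero in characteristic 0.\<close>

lemma irreducible_rat_poly_separable:
  fixes p :: "rat poly" and x :: "'a::field_char_0"
  assumes p: "Factorial_Ring.irreducible p" and "poly (map_poly of_rat p) x = 0"
  shows "poly (map_poly of_rat (pderiv p)) x \<noteq> 0"
proof
  assume "poly (map_poly of_rat (pderiv p)) x = 0"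
  with assms have "p dvd pderiv p" by (intro irreducible_rat_poly_dvd)
  moreover have "pderiv p \<noteq> 0"
    using irreducible_rat_poly_degree[OF p] by (simp add: pderiv_eq_0_iff)
  ultimately have "degree p \<le> degree (pderiv p)" by (intro dvd_imp_degree_le)
  with irreducible_rat_poly_degree[OF p] show False by (simp add: degree_pderiv)
qed

lemma ex_irreducible_rat_poly:
  fixes p :: "rat poly" and x :: "'a::field_char_0"
  assumes "p \<noteq> 0" "poly (map_poly of_rat p) x = 0"
  obtains q :: "rat poly" where "Factorial_Ring.irreducible q" "poly (map_poly of_rat q) x = 0"
  using rat_prime_factor_with_root[OF assms] prime_elem_imp_irreducible by blast

text \<open>The inverse is a Bezout coefficient with respect to an irreducible polynomial vanishing
  at \<open>x\<close>.\<close>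

lemma rat_poly_inverse:
  fixes p h :: "rat poly" and x :: "'a::field_char_0"
  assumes "p \<noteq> 0" "poly (map_poly of_rat p) x = 0" "poly (map_poly of_rat h) x \<noteq> 0"
  obtains u where "poly (map_poly of_rat u) x * poly (map_poly of_rat h) x = 1"
proof -
  obtain q :: "rat poly" where q: "Factorial_Ring.irreducible q" "poly (map_poly of_rat q) x = 0"
    using ex_irreducible_rat_poly[OF assms(1,2)] .
  have "\<not> q dvd h"
    using assms(3) q(2) by (auto simp: of_rat_hom.map_poly_hom)
  then have "coprime q h"
    using q(1) by (intro prime_elem_imp_coprime irreducible_imp_prime_elem)
  then have "fst (bezout_coefficients q h) * q + snd (bezout_coefficients q h) * h = 1"
    by (simp add: bezout_coefficients_fst_snd)
  then have "poly (map_poly of_rat (fst (bezout_coefficients q h) * q +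
      snd (bezout_coefficients q h) * h)) x = 1"
    by (simp add: of_rat_hom.map_poly_hom)
  with q(2) that[of "snd (bezout_coefficients q h)"] show ?thesis
    by (simp add: of_rat_hom.map_poly_hom)
qed

lemma rat_eval_pcompose:
  "poly (map_poly of_rat (g \<circ>\<^sub>p h)) x = poly (map_poly of_rat g) (poly (map_poly of_rat h) x)"
  by (simp add: of_rat_hom.map_poly_hom poly_pcompose)

subsection \<open>The subfield generated by an algebraic number\<close>

lemma complex_ring_simps [simp]:
  "carrier complex_ring = UNIV"
  "x \<otimes>\<^bsub>complex_ring\<^esub> y = x * y"
  "x \<oplus>\<^bsub>complex_ring\<^esub> y = x + y"
  "\<zero>\<^bsub>complex_ring\<^esub> = 0"
  "\<one>\<^bsub>complex_ring\<^esub> = 1"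
  by (simp_all add: ring_of_type_algebra_def)

interpretation complex_ring: cring complex_ring
  by (rule cring_from_type_algebra)

lemma field_complex_ring: "Ring.field complex_ring"
  by (rule field_from_type_algebra)

lemma complex_ring_a_inv [simp]: "\<ominus>\<^bsub>complex_ring\<^esub> x = - x"
  by (rule complex_ring.minus_equality) simp_all

lemma complex_ring_m_inv [simp]: "x \<noteq> 0 \<Longrightarrow> inv\<^bsub>complex_ring\<^esub> x = inverse x"
  by (rule complex_ring.comm_inv_char) simp_all

lemma subfield_complex_ringI:
  assumes "1 \<in> K" "\<And>x y. x \<in> K \<Longrightarrow> y \<in> K \<Longrightarrow> x + y \<in> K" "\<And>x. x \<in> K \<Longrightarrow> - x \<in> K"
    "\<And>x y. x \<in> K \<Longrightarrow> y \<in> K \<Longrightarrow> x * y \<in> K" "\<And>x. x \<in> K \<Longrightarrow> x \<noteq> 0 \<Longrightarrow> inverse x \<in> K"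
  shows "subfield K complex_ring"
proof (rule field.subfieldI'[OF field_complex_ring])
  show "subring K complex_ring"
    using assms by (intro complex_ring.subringI) auto
qed (use assms in auto)

text \<open>For algebraic \<open>y\<close> the polynomial expressions in \<open>y\<close> already
  form a field, by \<open>rat_poly_inverse\<close>; conversely each of them is built from
  \<open>y\<close> and rationals by ring operations.\<close>

lemma adjoin_rat_eq_range:
  assumes p: "p \<noteq> 0" "poly (map_poly of_rat p) y = 0"
  shows "adjoin \<rat> y = range (\<lambda>g. poly (map_poly of_rat g) y)" (is "_ = ?E")
proof
  have E: "poly (map_poly of_rat g) y \<in> ?E" for g by blast
  have "subfield ?E complex_ring"
  proof (rule subfield_complex_ringI)
    show "1 \<in> ?E" using E[of 1] by (simp add: of_rat_hom.map_poly_hom)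
    show "u + v \<in> ?E" "u * v \<in> ?E" "- u \<in> ?E" if uv: "u \<in> ?E" "v \<in> ?E" for u v
    proof -
      obtain g h where gh: "u = poly (map_poly of_rat g) y" "v = poly (map_poly of_rat h) y"
        using uv by blast
      show "u + v \<in> ?E" "u * v \<in> ?E" "- u \<in> ?E"
        using E[of "g + h"] E[of "g * h"] E[of "- g"] by (simp_all add: of_rat_hom.map_poly_hom gh)
    qed
    show "inverse u \<in> ?E" if u: "u \<in> ?E" "u \<noteq> 0" for u
    proof -
      obtain g where g: "u = poly (map_poly of_rat g) y" using u by blast
      then obtain v where "poly (map_poly of_rat v) y * poly (map_poly of_rat g) y = 1"
        using rat_poly_inverse p u by metis
      then have "inverse u = poly (map_poly of_rat v) y"
        using g u by (metis inverse_unique mult.commute)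
      then show ?thesis by blast
    qed
  qed
  moreover have "insert y \<rat> \<subseteq> ?E"
  proof -
    have "y \<in> ?E" using E[of "[:0, 1:]"] by (simp add: of_rat_hom.map_poly_hom)
    moreover have "of_rat r \<in> ?E" for r using E[of "[:r:]"] by (simp add: of_rat_hom.map_poly_hom)
    ultimately show ?thesis by (auto elim: Rats_cases)
  qed
  ultimately show "adjoin \<rat> y \<subseteq> ?E"
    unfolding adjoin_def by (intro field.generate_field_min_subfield1[OF field_complex_ring]) auto
next
  have "poly (map_poly of_rat g) y \<in> adjoin \<rat> y" for g
  proof (induction g)
    case 0
    have "0 \<in> adjoin \<rat> y"
      unfolding adjoin_def by (rule generate_field.incl) auto
    then show ?case by simp
  next
    case (pCons a g)
    have "of_rat a \<in> adjoin \<rat> y" "y \<in> adjoin \<rat> y"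
      unfolding adjoin_def by (auto intro: generate_field.incl)
    with pCons.IH have "of_rat a \<oplus>\<^bsub>complex_ring\<^esub> (y \<otimes>\<^bsub>complex_ring\<^esub> poly (map_poly of_rat g) y) \<in> adjoin \<rat> y"
      unfolding adjoin_def by (intro generate_field.eng_add generate_field.eng_mult)
    then show ?case by (simp add: of_rat_hom.map_poly_hom)
  qed
  then show "?E \<subseteq> adjoin \<rat> y" by blast
qed

subsection \<open>The third isomorphism theorem and the units modulo \<open>N\<close>\<close>

text \<open>The map \<open>A \<mapsto> H <#> A\<close> sends the coset \<open>K #> x\<close> to
  \<open>H #> x\<close>. It is a surjective homomorphism whose kernel consists of the cosets of
  \<open>K\<close> inside \<open>H\<close>, so the first isomorphism theorem applies.\<close>

lemma (in group) third_isomorphism: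
  assumes H: "H \<lhd> G" and K: "K \<lhd> G" and sub: "K \<subseteq> H"
  shows "carrier (G\<lparr>carrier := H\<rparr> Mod K) \<lhd> G Mod K"
    and "(G Mod K) Mod carrier (G\<lparr>carrier := H\<rparr> Mod K) \<cong> G Mod H"
proof -
  interpret H: normal H G by fact
  interpret K: normal K G by fact
  have HK: "H <#> K = H"
  proof
    show "H <#> K \<subseteq> H" using sub by (auto simp: set_mult_def)
    show "H \<subseteq> H <#> K"
    proof
      fix x assume "x \<in> H"
      then have "x = x \<otimes> \<one>" using H.subset by auto
      with \<open>x \<in> H\<close> show "x \<in> H <#> K"
        unfolding set_mult_def using K.one_closed by blast
    qed
  qed
  have coset: "H <#> (K #> x) = H #> x" if "x \<in> carrier G" for x
    using that by (simp add: setmult_rcos_assoc H.subset K.subset HK)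
  have carrier_K: "\<exists>x\<in>carrier G. A = K #> x" if "A \<in> carrier (G Mod K)" for A
    using that unfolding carrier_FactGroup by blast
  interpret h: group_hom "G Mod K" "G Mod H" "\<lambda>A. H <#> A"
  proof (intro group_hom.intro group_hom_axioms.intro K.factorgroup_is_group H.factorgroup_is_group homI)
    show "H <#> A \<in> carrier (G Mod H)" if A: "A \<in> carrier (G Mod K)" for A
      using carrier_K[OF A] coset unfolding carrier_FactGroup by blast
    show "H <#> (A \<otimes>\<^bsub>G Mod K\<^esub> B) = (H <#> A) \<otimes>\<^bsub>G Mod H\<^esub> (H <#> B)"
      if AB: "A \<in> carrier (G Mod K)" "B \<in> carrier (G Mod K)" for A B
    proof -
      obtain x y where xy: "x \<in> carrier G" "A = K #> x" "y \<in> carrier G" "B = K #> y"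
        using AB carrier_K by meson
      then show ?thesis
        by (simp only: mult_FactGroup K.rcos_sum H.rcos_sum coset m_closed)
    qed
  qed
  have "kernel (G Mod K) (G Mod H) (\<lambda>A. H <#> A) = (\<lambda>x. K #> x) ` H"
  proof -
    have "H #> x = H \<longleftrightarrow> x \<in> H" if "x \<in> carrier G" for x
      using that coset_join1 coset_join2 H.subgroup_axioms by blast
    then show ?thesis
      unfolding kernel_def one_FactGroup carrier_FactGroup using H.subset coset by blast
  qed
  also have "\<dots> = carrier (G\<lparr>carrier := H\<rparr> Mod K)"
    by (simp add: carrier_FactGroup r_coset_def)
  finally have ker: "kernel (G Mod K) (G Mod H) (\<lambda>A. H <#> A) = carrier (G\<lparr>carrier := H\<rparr> Mod K)" .
  show "carrier (G\<lparr>carrier := H\<rparr> Mod K) \<lhd> G Mod K"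
    using h.normal_kernel by (simp only: ker)
  have "(\<lambda>A. H <#> A) ` carrier (G Mod K) = carrier (G Mod H)"
    unfolding carrier_FactGroup image_image by (intro image_cong refl coset)
  then show "(G Mod K) Mod carrier (G\<lparr>carrier := H\<rparr> Mod K) \<cong> G Mod H"
    using h.FactGroup_iso by (simp only: ker)
qed

lemma unit_group_simps:
  "x \<otimes>\<^bsub>unit_group N\<^esub> y = x * y mod int N" "\<one>\<^bsub>unit_group N\<^esub> = 1 mod int N"
  by (simp_all add: unit_group_def units_of_def residue_ring_def)

lemma unit_group:
  assumes N: "N > 0"
  shows "comm_group (unit_group N)"
    and "carrier (unit_group N) = {a. 0 \<le> a \<and> a < int N \<and> coprime a (int N)}"
proof -
  let ?R = "residue_ring (int N) \<lparr>one := 1 mod int N\<rparr>"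
  have R: "carrier ?R = {0..<int N}" "x \<otimes>\<^bsub>?R\<^esub> y = x * y mod int N" "\<one>\<^bsub>?R\<^esub> = 1 mod int N" for x y
    by (auto simp: residue_ring_def)
  have "Group.comm_monoid ?R"
  proof (rule comm_monoidI, unfold R)
    fix x y z :: int
    show "x * y mod int N * z mod int N = x * (y * z mod int N) mod int N"
      by (simp only: mod_mult_left_eq mod_mult_right_eq mult.assoc)
    show "1 mod int N * x mod int N = x" if "x \<in> {0..<int N}"
      using that by (simp add: mod_mult_left_eq)
    show "x * y mod int N = y * x mod int N" by (simp only: mult.commute)
  qed (use N in auto)
  then show "comm_group (unit_group N)"
    unfolding unit_group_def by (rule comm_monoid.units_comm_group)
  have unit: "coprime x (int N) \<longleftrightarrow> (\<exists>y\<in>{0..<int N}. x * y mod int N = 1 mod int N)" for x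
    using coprime_iff_invertible'_int[of "int N" x] N by (auto simp: cong_def)
  have "carrier (unit_group N) = {x \<in> {0..<int N}. \<exists>y\<in>{0..<int N}. x * y mod int N = 1 mod int N}"
    unfolding unit_group_def units_of_def Units_def partial_object.simps R
    by (simp only: mult.commute conj_absorb)
  then show "carrier (unit_group N) = {a. 0 \<le> a \<and> a < int N \<and> coprime a (int N)}"
    by (simp add: unit conj_assoc)
qed

subsection \<open>Conjugates of the elements of a cyclotomic field\<close>

text \<open>\<open>(p(x) - p(y)) / (x - y)\<close>, expanded so that it also makes sense for \<open>x = y\<close>.\<close>

definition difference_quotient :: "'a::comm_ring_1 poly \<Rightarrow> 'a \<Rightarrow> 'a \<Rightarrow> 'a" where
  "difference_quotient p x y =
    (\<Sum>j\<le>degree p. coeff p j * (\<Sum>i<j. y ^ (j - Suc i) * x ^ i))"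

lemma difference_quotient_mult:
  "(x - y) * difference_quotient p x y = poly p x - poly p y"
proof -
  have "(x - y) * difference_quotient p x y =
      (\<Sum>j\<le>degree p. coeff p j * ((x - y) * (\<Sum>i<j. y ^ (j - Suc i) * x ^ i)))"
    unfolding difference_quotient_def
    by (subst sum_distrib_left) (simp only: mult.left_commute)
  also have "\<dots> = (\<Sum>j\<le>degree p. coeff p j * (x ^ j - y ^ j))"
    by (simp only: power_diff_sumr2)
  also have "\<dots> = poly p x - poly p y"
    by (simp add: poly_altdef right_diff_distrib sum_subtractf)
  finally show ?thesis .
qed

lemma difference_quotient_diag:
  fixes p :: "'a::{idom,ring_char_0} poly"
  shows "difference_quotient p x x = poly (pderiv p) x"
proof -
  \<comment> \<open>Differentiates termwise; on the diagonal the inner sum for \<open>j\<close>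
    consists of \<open>j\<close> equal terms \<open>x ^ (j - 1)\<close>.\<close>
  have "poly (pderiv p) x = (\<Sum>j\<le>degree p. poly (pderiv (monom (coeff p j) j)) x)"
    by (subst (1) poly_as_sum_of_monoms[symmetric])
      (simp only: higher_pderiv_sum[where n = 1, simplified] poly_sum)
  also have "\<dots> = difference_quotient p x x"
    unfolding difference_quotient_def
    by (intro sum.cong refl) (simp add: pderiv_monom poly_monom flip: power_add)
  finally show ?thesis by simp
qed

locale primitive_root_of_unity =
  fixes N :: nat and \<zeta> :: complex
  assumes N_pos: "N > 0" and root: "\<zeta> ^ N = 1"
    and primitive: "0 < k \<Longrightarrow> k < N \<Longrightarrow> \<zeta> ^ k \<noteq> 1"
begin

text \<open>Least non-negative representatives, matching the carrier of \<open>unit_group N\<close>.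
  For \<open>N = 1\<close> the only element is 0, so the identity is represented by
  \<open>1 mod N\<close>.\<close>

definition totatives_below :: "nat set" where
  "totatives_below = {a. a < N \<and> coprime a N}"

abbreviation val :: "rat poly \<Rightarrow> nat \<Rightarrow> complex" where
  "val f a \<equiv> poly (map_poly of_rat f) (\<zeta> ^ a)"

lemma finite_totatives [simp]: "finite totatives_below"
  by (simp add: totatives_below_def)

lemma power_mod: "\<zeta> ^ (k mod N) = \<zeta> ^ k"
  by (metis div_mult_mod_eq mult.commute power_add power_mult power_one root mult_1)

lemma val_monom: "val (f \<circ>\<^sub>p monom 1 a) b = val f (a * b)"
  by (simp add: of_rat_hom.map_poly_hom poly_pcompose poly_monom flip: power_mult)
    (simp add: mult.commute)

text \<open>Dedekind's theorem applied to \<open>f - g\<close>. It says that sending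
  \<open>g(\<zeta>)\<close> to \<open>g(\<zeta>^a)\<close> does not depend on the choice of
  \<open>g\<close>.\<close>

lemma val_cong:
  assumes "val f 1 = val g 1" "coprime a N"
  shows "val f a = val g a"
proof -
  have "poly (map_poly of_rat (f - g)) (\<zeta> ^ a) = 0"
    using assms N_pos root
    by (intro rat_poly_root_of_unity_power[of N]) (simp_all add: of_rat_hom.map_poly_hom)
  then show ?thesis by (simp add: of_rat_hom.map_poly_hom)
qed

lemma ex_rat_poly_root: "\<exists>p :: rat poly. p \<noteq> 0 \<and> poly (map_poly of_rat p) \<zeta> = 0"
proof (intro exI conjI)
  have "coeff (monom 1 N - 1 :: rat poly) N = 1" using N_pos by simp
  then show "monom 1 N - 1 \<noteq> (0 :: rat poly)" by (metis coeff_0 zero_neq_one)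
qed (simp add: of_rat_hom.map_poly_hom poly_monom root)

text \<open>
  The product of the \<open>x\<^sup>d - 1\<close> with \<open>0 < d < N\<close> vanishes exactly at the non-primitive \<open>N\<close>-th roots of
  unity; multiply it by a rational expression for its inverse at \<open>\<zeta>\<close>.
\<close>

lemma ex_val_totatives_indicator:
  "\<exists>e. \<forall>a<N. val e a = (if coprime a N then 1 else 0)"
proof -
  define k :: "rat poly" where "k = (\<Prod>d\<in>{1..<N}. monom 1 d - 1)"
  have k: "val k a = (\<Prod>d\<in>{1..<N}. (\<zeta> ^ a) ^ d - 1)" for a
    by (simp add: k_def of_rat_hom.map_poly_hom poly_prod poly_monom)
  have "val k 1 \<noteq> 0"
    unfolding k using primitive by (subst prod_zero_iff) auto
  then obtain u where u: "val u 1 * val k 1 = 1"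
    using ex_rat_poly_root rat_poly_inverse by (metis power_one_right)
  show ?thesis
  proof (intro exI[of _ "u * k"] allI impI)
    fix a assume a: "a < N"
    show "val (u * k) a = (if coprime a N then 1 else 0)"
    proof (cases "coprime a N")
      case True
      have "val (u * k) 1 = val 1 1" using u by (simp add: of_rat_hom.map_poly_hom)
      then have "val (u * k) a = val 1 a" using True by (rule val_cong)
      with True show ?thesis by (simp add: of_rat_hom.map_poly_hom)
    next
      case False
      \<comment> \<open>The order of \<open>\<zeta> ^ a\<close>; it is below \<open>N\<close>
        because \<open>a\<close> and \<open>N\<close> have a common factor, so the factor of
        \<open>k\<close> with index \<open>d\<close> vanishes.\<close>
      define d where "d = N div gcd a N"
      have "gcd a N \<noteq> 1" using False by (simp add: coprime_iff_gcd_eq_1)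
      moreover have "gcd a N \<noteq> 0" using N_pos by simp
      ultimately have "gcd a N > 1" by linarith
      then have d: "d \<in> {1..<N}"
        using N_pos by (auto simp: d_def Suc_le_eq div_greater_zero_iff intro: gcd_le2_nat)
      have "(\<zeta> ^ a) ^ d = (\<zeta> ^ N) ^ (a div gcd a N)"
        unfolding d_def power_mult[symmetric]
        by (metis div_mult_swap dvd_div_mult gcd_dvd1 gcd_dvd2 mult.commute)
      then have "(\<zeta> ^ a) ^ d - 1 = 0" by (simp add: root)
      with d have "val k a = 0" unfolding k by (intro prod_zero) auto
      with False show ?thesis by (simp add: of_rat_hom.map_poly_hom)
    qed
  qed
qed

section \<open>Rationality of traces\<close>

lemma sum_powers_rat: "(\<Sum>j<N. (\<zeta> ^ j) ^ i) \<in> \<rat>"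
proof (cases "\<zeta> ^ i = 1")
  case True
  then have "(\<zeta> ^ j) ^ i = 1" for j by (metis mult.commute power_mult power_one)
  then show ?thesis by simp
next
  case False
  have "(\<Sum>j<N. (\<zeta> ^ j) ^ i) = (\<Sum>j<N. (\<zeta> ^ i) ^ j)"
    by (simp add: mult.commute flip: power_mult)
  also have "\<dots> = ((\<zeta> ^ i) ^ N - 1) / (\<zeta> ^ i - 1)"
    using False by (rule geometric_sum)
  also have "(\<zeta> ^ i) ^ N = 1" by (metis mult.commute power_mult power_one root)
  finally show ?thesis by simp
qed

lemma sum_val_rat: "(\<Sum>j<N. val f j) \<in> \<rat>"
proof -
  \<comment> \<open>The extra factor with exponent \<open>i\<close> carries the induction: splitting
    off the constant coefficient of \<open>f\<close> raises \<open>i\<close> by one.\<close>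
  have "(\<Sum>j<N. val f j * (\<zeta> ^ j) ^ i) \<in> \<rat>" for i
  proof (induction f arbitrary: i)
    case (pCons a f)
    have "(\<Sum>j<N. val (pCons a f) j * (\<zeta> ^ j) ^ i) =
        of_rat a * (\<Sum>j<N. (\<zeta> ^ j) ^ i) + (\<Sum>j<N. val f j * (\<zeta> ^ j) ^ Suc i)"
      by (simp add: of_rat_hom.map_poly_hom sum_distrib_left algebra_simps flip: sum.distrib)
    then show ?case using pCons.IH[of "Suc i"] sum_powers_rat by simp
  qed simp
  from this[of 0] show ?thesis by simp
qed

text \<open>The indicator of the totatives is itself given by a rational polynomial
  \<open>e\<close>, so this trace is the sum of the values of \<open>f * e\<close> over all
  residues.\<close>

lemma sum_totatives_val_rat: "(\<Sum>a\<in>totatives_below. val f a) \<in> \<rat>"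
proof -
  obtain e where e: "\<And>a. a < N \<Longrightarrow> val e a = (if coprime a N then 1 else 0)"
    using ex_val_totatives_indicator by blast
  have "(\<Sum>j<N. val (f * e) j) = (\<Sum>j<N. if coprime j N then val f j else 0)"
    by (intro sum.cong) (simp_all add: of_rat_hom.map_poly_hom e)
  also have "\<dots> = (\<Sum>a\<in>totatives_below. val f a)"
    unfolding totatives_below_def
    by (subst sum.inter_filter[symmetric]) (auto simp: lessThan_def intro!: sum.cong)
  finally show ?thesis using sum_val_rat[of "f * e"] by simp
qed

lemma ex_trace_interpolation:
  fixes p f h :: "rat poly"
  assumes p: "\<And>a. a \<in> totatives_below \<Longrightarrow> poly (map_poly of_rat p) (val f a) = 0"
    and "degree p > 0"
  obtains T :: "rat poly" where "degree T < degree p"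
    "\<And>x. poly (map_poly of_rat p) x = 0 \<Longrightarrow>
      poly (map_poly of_rat T) x =
        poly (map_poly of_rat (pderiv p)) x * (\<Sum>a | a \<in> totatives_below \<and> val f a = x. val h a)"
proof -
  \<comment> \<open>Expanding the difference quotients in powers of \<open>x\<close> leaves
    coefficients that are rational combinations of the traces of \<open>h * f ^ k\<close>;
    \<open>t k\<close> is such a trace.\<close>
  have "\<exists>t. \<forall>k. of_rat (t k) = (\<Sum>a\<in>totatives_below. val h a * val f a ^ k)"
  proof (intro choice allI)
    fix k
    have "(\<Sum>a\<in>totatives_below. val h a * val f a ^ k) \<in> \<rat>"
      using sum_totatives_val_rat[of "h * f ^ k"] by (simp add: of_rat_hom.map_poly_hom)
    then show "\<exists>r. of_rat r = (\<Sum>a\<in>totatives_below. val h a * val f a ^ k)"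
      by (metis Rats_cases)
  qed
  then obtain t where t: "\<And>k. of_rat (t k) = (\<Sum>a\<in>totatives_below. val h a * val f a ^ k)"
    by blast
  define T where "T = (\<Sum>j\<le>degree p. \<Sum>i<j. monom (coeff p j * t (j - Suc i)) i)"
  have T: "poly (map_poly of_rat T) x =
      (\<Sum>a\<in>totatives_below. val h a * difference_quotient (map_poly of_rat p) x (val f a))" for x
  proof -
    have "poly (map_poly of_rat T) x = (\<Sum>j\<le>degree p. \<Sum>i<j.
        \<Sum>a\<in>totatives_below. val h a * (of_rat (coeff p j) * (val f a ^ (j - Suc i) * x ^ i)))"
      by (simp add: T_def of_rat_hom.map_poly_hom poly_sum poly_monom of_rat_mult t
          sum_distrib_left sum_distrib_right mult_ac)
    also have "\<dots> = (\<Sum>a\<in>totatives_below. \<Sum>j\<le>degree p. \<Sum>i<j.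
        val h a * (of_rat (coeff p j) * (val f a ^ (j - Suc i) * x ^ i)))"
      by (subst sum.swap, subst sum.swap) (intro sum.cong refl sum.swap)
    also have "\<dots> = (\<Sum>a\<in>totatives_below. val h a * difference_quotient (map_poly of_rat p) x (val f a))"
      by (simp add: difference_quotient_def coeff_map_poly degree_map_poly sum_distrib_left)
    finally show ?thesis .
  qed
  show ?thesis
  proof (rule that)
    show "degree T < degree p"
    proof -
      have "degree T \<le> degree p - 1"
        unfolding T_def
        by (intro degree_sum_le) (auto intro: order.trans[OF degree_monom_le])
      with assms(2) show ?thesis by linarith
    qed
  next
    fix x :: complex
    assume x: "poly (map_poly of_rat p) x = 0"
    have "poly (map_poly of_rat T) x =
        (\<Sum>a\<in>totatives_below. if val f a = x
          then poly (map_poly of_rat (pderiv p)) x * val h a else 0)"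
      unfolding T
    proof (intro sum.cong refl)
      fix a assume a: "a \<in> totatives_below"
      \<comment> \<open>Both \<open>x\<close> and \<open>val f a\<close> are roots of
        \<open>p\<close>: either they agree and the quotient is the derivative, or the quotient is
        zero.\<close>
      have "(x - val f a) * difference_quotient (map_poly of_rat p) x (val f a) = 0"
        by (simp add: difference_quotient_mult x p[OF a])
      then show "val h a * difference_quotient (map_poly of_rat p) x (val f a) =
          (if val f a = x then poly (map_poly of_rat (pderiv p)) x * val h a else 0)"
        by (auto simp: difference_quotient_diag of_rat_hom.map_poly_hom)
    qed
    also have "\<dots> = poly (map_poly of_rat (pderiv p)) x *
        (\<Sum>a | a \<in> totatives_below \<and> val f a = x. val h a)"
      by (simp add: sum.inter_filter sum_distrib_left if_distrib cong: if_cong)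
    finally show "poly (map_poly of_rat T) x = poly (map_poly of_rat (pderiv p)) x *
        (\<Sum>a | a \<in> totatives_below \<and> val f a = x. val h a)" .
  qed
qed

text \<open>Linear algebra over the rationals: all powers of \<open>val f 1\<close> lie in the span
  of the \<open>N\<close> powers of \<open>\<zeta>\<close>, so the first \<open>N + 1\<close> of
  them satisfy a linear relation.\<close>

lemma ex_rat_poly_val_root: "\<exists>p :: rat poly. p \<noteq> 0 \<and> poly (map_poly of_rat p) (val f 1) = 0"
proof -
  interpret vector_space "\<lambda>(r :: rat) (x :: complex). of_rat r * x"
    by standard (simp_all add: algebra_simps of_rat_add of_rat_mult)
  define B where "B = (\<lambda>i. \<zeta> ^ i) ` {..<N}"
  have B: "\<zeta> ^ i \<in> span B" for i
    using N_pos power_mod[of i] by (intro span_base) (auto simp: B_def intro!: image_eqI[of _ _ "i mod N"])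
  have "val h 1 * \<zeta> ^ i \<in> span B" for h i
  proof (induction h arbitrary: i)
    case (pCons a h)
    have "val (pCons a h) 1 * \<zeta> ^ i = of_rat a * \<zeta> ^ i + val h 1 * \<zeta> ^ Suc i"
      by (simp add: of_rat_hom.map_poly_hom algebra_simps)
    then show ?case
      using span_add[OF span_scale[OF B, of a i] pCons.IH[of "Suc i"]] by simp
  qed (simp add: span_zero)
  from this[of "f ^ _" 0] have power: "val f 1 ^ k \<in> span B" for k
    by (simp add: of_rat_hom.map_poly_hom)
  show ?thesis
  \<comment> \<open>Linear dependence is a property of sets, in which repeated powers would
    collapse; two equal powers give the relation directly.\<close>
  proof (cases "inj_on (\<lambda>k. val f 1 ^ k) {..N}")
    case True
    define V where "V = (\<lambda>k. val f 1 ^ k) ` {..N}"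
    have "card V = Suc N" using True by (simp add: V_def card_image)
    moreover have "card B \<le> N" unfolding B_def using card_image_le[of "{..<N}"] by simp
    moreover have "finite B" by (simp add: B_def)
    moreover have "V \<subseteq> span B" using power by (auto simp: V_def)
    ultimately have "dependent V"
      using independent_span_bound[of B V] by auto
    moreover have "finite V" by (simp add: V_def)
    ultimately obtain u v where uv: "v \<in> V" "u v \<noteq> 0" "(\<Sum>v\<in>V. of_rat (u v) * v) = 0"
      using dependent_finite by blast
    from uv(1) obtain k where k: "k \<le> N" "v = val f 1 ^ k" by (auto simp: V_def)
    define p where "p = (\<Sum>k\<le>N. monom (u (val f 1 ^ k)) k)"
    have "coeff p k \<noteq> 0"
      using k uv(2) by (simp add: p_def coeff_sum)
    moreover have "poly (map_poly of_rat p) (val f 1) = (\<Sum>k\<le>N. of_rat (u (val f 1 ^ k)) * val f 1 ^ k)"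
      by (simp add: p_def of_rat_hom.map_poly_hom poly_sum poly_monom)
    moreover have "\<dots> = (\<Sum>v\<in>V. of_rat (u v) * v)"
      unfolding V_def using True by (subst sum.reindex) auto
    ultimately show ?thesis using uv(3) by (intro exI[of _ p]) auto
  next
    case False
    then obtain i j where ij: "i \<noteq> j" "val f 1 ^ i = val f 1 ^ j" by (auto simp: inj_on_def)
    have "coeff (monom 1 i - monom 1 j :: rat poly) i = 1" using ij by simp
    then have "monom 1 i - monom 1 j \<noteq> (0 :: rat poly)" by (metis coeff_0 zero_neq_one)
    moreover have "poly (map_poly of_rat (monom 1 i - monom 1 j)) (val f 1) = 0"
      using ij(2) by (simp add: of_rat_hom.map_poly_hom poly_monom)
    ultimately show ?thesis by blast
  qed
qed

section \<open>Stabilisers, conjugates and normality\<close>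

lemma one_mod_totative: "1 mod N \<in> totatives_below"
  unfolding totatives_below_def using N_pos by (cases "N = 1") auto

lemma val_one_mod: "val f (1 mod N) = val f 1"
  by (simp only: power_mod)

lemma val_conjugate_root:
  assumes "poly (map_poly of_rat p) (val f 1) = 0" "coprime a N"
  shows "poly (map_poly of_rat p) (val f a) = 0"
proof -
  have "val (p \<circ>\<^sub>p f) 1 = val 0 1"
    using assms(1) by (simp add: of_rat_hom.map_poly_hom poly_pcompose)
  then have "val (p \<circ>\<^sub>p f) a = val 0 a" using assms(2) by (rule val_cong)
  then show ?thesis by (simp add: of_rat_hom.map_poly_hom poly_pcompose)
qed

text \<open>The index set is finite and contains \<open>1 mod N\<close>, so the sum is a positive
  multiple of \<open>c\<close>. This keeps the interpolation polynomial for \<open>h = 1\<close>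
  from vanishing at \<open>val f 1\<close>.\<close>

lemma sum_stabilizer:
  "(\<Sum>a | a \<in> totatives_below \<and> val f a = val f 1. c) \<noteq> (0 :: complex) \<longleftrightarrow> c \<noteq> 0"
proof -
  have "{a. a \<in> totatives_below \<and> val f a = val f 1} \<noteq> {}"
    using one_mod_totative val_one_mod by blast
  moreover have "finite {a. a \<in> totatives_below \<and> val f a = val f 1}"
    by (rule finite_subset[OF _ finite_totatives]) auto
  ultimately show ?thesis by simp
qed

text \<open>Stands in for the fixed field theorem. At \<open>val f 1\<close> the interpolation
  polynomial equals the derivative of \<open>p\<close> times \<open>card H * val h 1\<close>; both
  the derivative and \<open>card H\<close> can be inverted within the field generated by
  \<open>val f 1\<close>.\<close>

lemma val_in_adjoin_of_stabilized:
  assumes fixed: "\<And>b. b \<in> totatives_below \<Longrightarrow> val f b = val f 1 \<Longrightarrow> val h b = val h 1"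
  obtains g where "val h 1 = poly (map_poly of_rat g) (val f 1)"
proof -
  obtain p :: "rat poly" where p: "Factorial_Ring.irreducible p" "poly (map_poly of_rat p) (val f 1) = 0"
    using ex_rat_poly_val_root ex_irreducible_rat_poly by metis
  have "poly (map_poly of_rat p) (val f a) = 0" if "a \<in> totatives_below" for a
    using val_conjugate_root[OF p(2)] that by (simp add: totatives_below_def)
  then obtain T where T: "\<And>x. poly (map_poly of_rat p) x = 0 \<Longrightarrow>
      poly (map_poly of_rat T) x =
        poly (map_poly of_rat (pderiv p)) x * (\<Sum>a | a \<in> totatives_below \<and> val f a = x. val h a)"
    using ex_trace_interpolation[where p = p and f = f and h = h]
      irreducible_rat_poly_degree[OF p(1)] by blast
  define H where "H = {a. a \<in> totatives_below \<and> val f a = val f 1}"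
  have H: "card H \<noteq> 0"
    using sum_stabilizer[where f = f and c = 1] by (simp add: H_def)
  have "(\<Sum>a\<in>H. val h a) = (\<Sum>a\<in>H. val h 1)"
    by (intro sum.cong refl fixed) (auto simp: H_def)
  then have T1: "poly (map_poly of_rat T) (val f 1) =
      poly (map_poly of_rat (pderiv p)) (val f 1) * (of_nat (card H) * val h 1)"
    using T[OF p(2)] by (simp add: H_def)
  obtain u where u: "poly (map_poly of_rat u) (val f 1) * poly (map_poly of_rat (pderiv p)) (val f 1) = 1"
    using p irreducible_rat_poly_separable[OF p] irreducible_rat_poly_degree[OF p(1)]
    by (elim rat_poly_inverse[of p, rotated]) auto
  have "val h 1 = poly (map_poly of_rat (smult (1 / of_nat (card H)) (u * T))) (val f 1)"
  proof -
    let ?c = "of_nat (card H) :: complex"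
    have "poly (map_poly of_rat (smult (1 / of_nat (card H)) (u * T))) (val f 1) =
        1 / ?c * (poly (map_poly of_rat u) (val f 1) * poly (map_poly of_rat T) (val f 1))"
      by (simp add: of_rat_hom.map_poly_smult of_rat_hom.map_poly_mult of_rat_divide)
    also have "\<dots> = 1 / ?c * ((poly (map_poly of_rat u) (val f 1) *
        poly (map_poly of_rat (pderiv p)) (val f 1)) * (?c * val h 1))"
      by (simp only: T1 mult.assoc)
    also have "\<dots> = val h 1"
      using H by (simp only: u) simp
    finally show ?thesis by simp
  qed
  then show ?thesis by (rule that)
qed

text \<open>Commutativity enters here: if replacing \<open>\<zeta>\<close> by
  \<open>\<zeta> ^ b\<close> fixes \<open>f(\<zeta>)\<close>, it also fixes
  \<open>f(\<zeta>^a)\<close>, because the exponents multiply to \<open>a * b\<close> in either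
  order.\<close>

lemma conjugate_in_adjoin:
  assumes "coprime a N"
  obtains g where "val f a = poly (map_poly of_rat g) (val f 1)"
proof -
  have "val (f \<circ>\<^sub>p monom 1 a) b = val (f \<circ>\<^sub>p monom 1 a) 1"
    if "val f b = val f 1" for b
  proof -
    have "val (f \<circ>\<^sub>p monom 1 b) 1 = val f 1" using that by (simp only: val_monom mult_1_right)
    then have "val (f \<circ>\<^sub>p monom 1 b) a = val f a" using assms by (rule val_cong)
    then show ?thesis by (simp only: val_monom mult.commute mult_1)
  qed
  then obtain g where "val (f \<circ>\<^sub>p monom 1 a) 1 = poly (map_poly of_rat g) (val f 1)"
    using val_in_adjoin_of_stabilized[of f "f \<circ>\<^sub>p monom 1 a"] by metis
  with that show ?thesis by (simp only: val_monom mult_1_right)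
qed

text \<open>If \<open>r\<close> were not a conjugate, the interpolation polynomial for
  \<open>h = 1\<close> would vanish at \<open>r\<close> and be divisible by \<open>p\<close>; yet it
  is nonzero at \<open>val f 1\<close> and has smaller degree than \<open>p\<close>.\<close>

lemma conjugates_exhaust_roots:
  fixes p :: "rat poly"
  assumes p: "Factorial_Ring.irreducible p" "poly (map_poly of_rat p) (val f 1) = 0"
    and r: "poly (map_poly of_rat p) r = 0"
  obtains a where "a \<in> totatives_below" "r = val f a"
proof -
  have "\<exists>a\<in>totatives_below. val f a = r"
  proof (rule ccontr)
    assume "\<not> ?thesis"
    then have empty: "{a. a \<in> totatives_below \<and> val f a = r} = {}" by blast
    have "poly (map_poly of_rat p) (val f a) = 0" if "a \<in> totatives_below" for a
      using val_conjugate_root[OF p(2)] that by (simp add: totatives_below_def)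
    then obtain T where deg: "degree T < degree p"
      and T: "\<And>x. poly (map_poly of_rat p) x = 0 \<Longrightarrow>
        poly (map_poly of_rat T) x =
          poly (map_poly of_rat (pderiv p)) x * (\<Sum>a | a \<in> totatives_below \<and> val f a = x. val 1 a)"
      using ex_trace_interpolation[where p = p and f = f and h = 1]
        irreducible_rat_poly_degree[OF p(1)] by blast
    have "poly (map_poly of_rat T) (val f 1) \<noteq> 0"
      unfolding T[OF p(2)]
      using sum_stabilizer[where f = f and c = 1] irreducible_rat_poly_separable[OF p]
      by (simp add: of_rat_hom.map_poly_one)
    then have "T \<noteq> 0" by auto
    moreover have "poly (map_poly of_rat T) r = 0"
      using T[OF r] by (simp only: empty sum.empty mult_zero_right)
    then have "p dvd T" using p(1) r by (intro irreducible_rat_poly_dvd)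
    ultimately have "degree p \<le> degree T" by (intro dvd_imp_degree_le)
    with deg show False by simp
  qed
  with that show ?thesis by blast
qed

lemma adjoin_val_eq: "adjoin \<rat> (val f 1) = range (\<lambda>g. poly (map_poly of_rat g) (val f 1))"
  using adjoin_rat_eq_range ex_rat_poly_val_root by blast

lemma galois_over_rat_adjoin_val: "galois_over_rat (adjoin \<rat> (val f 1))" (is "galois_over_rat ?L")
  unfolding galois_over_rat_def
proof (intro conjI ballI allI impI)
  show "subfield ?L complex_ring"
    unfolding adjoin_def by (rule field.generate_field_is_subfield[OF field_complex_ring]) simp
  \<comment> \<open>Each element of the field is itself a value at \<open>\<zeta>\<close>, so the
    results on \<open>val f 1\<close> apply to it with \<open>g \<circ>\<^sub>p f\<close> in place
    of \<open>f\<close>.\<close>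
  have repr: "\<exists>g. x = val (g \<circ>\<^sub>p f) 1" if "x \<in> ?L" for x
    using that unfolding adjoin_val_eq by (auto simp: of_rat_hom.map_poly_hom poly_pcompose)
  show "Polynomial.algebraic x" if x: "x \<in> ?L" for x
  proof -
    obtain p :: "rat poly" where "p \<noteq> 0" "poly (map_poly of_rat p) x = 0"
      using repr[OF x] ex_rat_poly_val_root by metis
    then show ?thesis
      by (intro algebraicI'[of "map_poly of_rat p"]) (auto simp: coeff_map_poly map_poly_eq_0_iff)
  qed
  fix p :: "rat poly"
  assume p: "Factorial_Ring.irreducible p" and root: "\<exists>x\<in>?L. poly (map_poly of_rat p) x = 0"
  show "rsquarefree (map_poly of_rat p :: complex poly)"
    using irreducible_rat_poly_separable[OF p]
    by (auto simp: rsquarefree_roots simp flip: of_rat_hom.map_poly_pderiv)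
  obtain g where g: "poly (map_poly of_rat p) (val (g \<circ>\<^sub>p f) 1) = 0"
    using root repr by blast
  have roots: "r \<in> ?L" if r: "poly (map_poly of_rat p) r = 0" for r
  proof -
    obtain a where a: "a \<in> totatives_below" "r = val (g \<circ>\<^sub>p f) a"
      using conjugates_exhaust_roots[OF p g r] .
    obtain k where "val f a = poly (map_poly of_rat k) (val f 1)"
      using conjugate_in_adjoin a(1) unfolding totatives_below_def by blast
    then have "r = poly (map_poly of_rat (g \<circ>\<^sub>p k)) (val f 1)"
      using a(2) by (simp add: of_rat_hom.map_poly_hom poly_pcompose)
    then show ?thesis unfolding adjoin_val_eq by blast
  qed
  obtain xs where xs: "mset xs = proots (map_poly of_rat p :: complex poly)"
    using ex_mset by blast
  have "p \<noteq> 0" using p by auto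
  show "splits_over ?L (map_poly of_rat p)"
    unfolding splits_over_def
  proof (intro bexI exI conjI)
    show "map_poly of_rat p =
        smult (of_rat (lead_coeff p)) (\<Prod>x\<leftarrow>xs. [:- x, 1:])"
      using complex_poly_decompose_multiset[of "map_poly of_rat p"]
      by (simp add: coeff_map_poly degree_map_poly flip: xs prod_mset_prod_list)
    have "set xs = {x. poly (map_poly of_rat p) x = 0}"
      unfolding set_mset_mset[symmetric] xs using \<open>p \<noteq> 0\<close> by (simp add: map_poly_eq_0_iff)
    then show "set xs \<subseteq> ?L" using roots by auto
    show "of_rat (lead_coeff p) \<in> ?L"
      unfolding adjoin_def by (rule generate_field.incl) simp
  qed
qed

subsection \<open>The Galois group of the field generated by an element\<close>

text \<open>The automorphism induced by sending \<open>\<zeta>\<close> to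
  \<open>\<zeta> ^ a\<close>. For \<open>a\<close> coprime to \<open>N\<close> the choice of
  \<open>g\<close> is immaterial by \<open>val_cong\<close>; the restriction to the field makes it
  extensional, as \<open>BijGroup\<close> demands.\<close>

definition conjugation :: "rat poly \<Rightarrow> nat \<Rightarrow> complex \<Rightarrow> complex" where
  "conjugation f a = (\<lambda>x\<in>adjoin \<rat> (val f 1).
     poly (map_poly of_rat (SOME g. x = poly (map_poly of_rat g) (val f 1))) (val f a))"

lemma adjoin_valI: "poly (map_poly of_rat g) (val f 1) \<in> adjoin \<rat> (val f 1)"
  unfolding adjoin_val_eq by (rule rangeI)

lemma adjoin_valE:
  assumes "x \<in> adjoin \<rat> (val f 1)"
  obtains g where "x = poly (map_poly of_rat g) (val f 1)"
  using assms unfolding adjoin_val_eq by (elim rangeE) (rule that)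

lemma poly_val_cong:
  assumes "poly (map_poly of_rat g) (val f 1) = poly (map_poly of_rat k) (val h 1)" "coprime a N"
  shows "poly (map_poly of_rat g) (val f a) = poly (map_poly of_rat k) (val h a)"
proof -
  have "val (g \<circ>\<^sub>p f) 1 = val (k \<circ>\<^sub>p h) 1"
    unfolding rat_eval_pcompose by (rule assms(1))
  then have "val (g \<circ>\<^sub>p f) a = val (k \<circ>\<^sub>p h) a" using assms(2) by (rule val_cong)
  then show ?thesis unfolding rat_eval_pcompose .
qed

lemma conjugation_apply:
  assumes "coprime a N"
  shows "conjugation f a (poly (map_poly of_rat g) (val f 1)) = poly (map_poly of_rat g) (val f a)"
proof -
  define x where "x = poly (map_poly of_rat g) (val f 1)"
  define k where "k = (SOME g. x = poly (map_poly of_rat g) (val f 1))"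
  have "x = poly (map_poly of_rat k) (val f 1)"
    unfolding k_def by (rule someI[of _ g]) (rule x_def)
  then have "poly (map_poly of_rat k) (val f 1) = poly (map_poly of_rat g) (val f 1)"
    unfolding x_def by (rule sym)
  then have eq: "poly (map_poly of_rat k) (val f a) = poly (map_poly of_rat g) (val f a)"
    using assms by (rule poly_val_cong)
  have "x \<in> adjoin \<rat> (val f 1)"
    unfolding x_def by (rule adjoin_valI)
  then have "conjugation f a x = poly (map_poly of_rat k) (val f a)"
    unfolding conjugation_def k_def by (rule restrict_apply')
  also note eq
  finally show ?thesis unfolding x_def .
qed

lemma conjugation_compose:
  assumes ab: "coprime a N" "coprime b N" and x: "x \<in> adjoin \<rat> (val f 1)"
  shows "conjugation f b x \<in> adjoin \<rat> (val f 1)"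
    and "conjugation f a (conjugation f b x) = conjugation f (a * b) x"
proof -
  obtain g where g: "x = poly (map_poly of_rat g) (val f 1)"
    using x by (rule adjoin_valE)
  obtain k where k: "val f b = poly (map_poly of_rat k) (val f 1)"
    using conjugate_in_adjoin[OF ab(2)] .
  have 1: "conjugation f b x = poly (map_poly of_rat (g \<circ>\<^sub>p k)) (val f 1)"
    by (simp only: g conjugation_apply[OF ab(2)] k rat_eval_pcompose)
  then show "conjugation f b x \<in> adjoin \<rat> (val f 1)"
    by (simp only: adjoin_valI)
  \<comment> \<open>The relation \<open>val f b = k(val f 1)\<close> is conjugated by
    \<open>a\<close>, which turns it into \<open>val f (a * b) = k(val f a)\<close>.\<close>
  have "val (f \<circ>\<^sub>p monom 1 b) 1 = val f b"
    unfolding val_monom by simp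
  also have "\<dots> = val (k \<circ>\<^sub>p f) 1"
    unfolding rat_eval_pcompose by (rule k)
  finally have "val (f \<circ>\<^sub>p monom 1 b) a = val (k \<circ>\<^sub>p f) a" using ab(1) by (rule val_cong)
  then have "val f (b * a) = poly (map_poly of_rat k) (val f a)"
    by (simp only: val_monom rat_eval_pcompose[of k])
  then have "poly (map_poly of_rat k) (val f a) = val f (a * b)"
    by (simp only: mult.commute)
  moreover have "conjugation f a (conjugation f b x) = poly (map_poly of_rat (g \<circ>\<^sub>p k)) (val f a)"
    unfolding 1 by (rule conjugation_apply[OF ab(1)])
  ultimately have "conjugation f a (conjugation f b x) = poly (map_poly of_rat g) (val f (a * b))"
    by (simp only: rat_eval_pcompose)
  also have "\<dots> = conjugation f (a * b) x"
  proof -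
    have "coprime (a * b) N" using ab by simp
    then show ?thesis unfolding g by (rule conjugation_apply[symmetric])
  qed
  finally show "conjugation f a (conjugation f b x) = conjugation f (a * b) x" .
qed

lemma conjugation_mod: "conjugation f (a mod N) = conjugation f a"
  by (simp only: conjugation_def power_mod)

lemma conjugation_one:
  assumes "x \<in> adjoin \<rat> (val f 1)"
  shows "conjugation f 1 x = x"
proof -
  obtain g where "x = poly (map_poly of_rat g) (val f 1)" using assms by (rule adjoin_valE)
  then show ?thesis by (simp only: conjugation_apply[OF coprime_1_left])
qed

text \<open>A conjugation is determined by its value at the generator \<open>val f 1\<close>. This
  identifies the kernel of the action with the stabiliser.\<close>

lemma conjugation_eq_id_iff:
  assumes "coprime a N"
  shows "conjugation f a = (\<lambda>x\<in>adjoin \<rat> (val f 1). x) \<longleftrightarrow> val f a = val f 1"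
proof
  have eval: "poly (map_poly of_rat [:0, 1:]) x = x" for x :: complex
    by (simp add: of_rat_hom.map_poly_hom)
  assume id: "conjugation f a = (\<lambda>x\<in>adjoin \<rat> (val f 1). x)"
  have "val f a = conjugation f a (val f 1)"
    using conjugation_apply[OF assms, of f "[:0, 1:]"] unfolding eval ..
  also have "\<dots> = val f 1"
    using adjoin_valI[of "[:0, 1:]" f] unfolding id eval by (rule restrict_apply')
  finally show "val f a = val f 1" .
next
  assume "val f a = val f 1"
  then have "conjugation f a = conjugation f 1"
    unfolding conjugation_def by presburger
  also have "\<dots> = (\<lambda>x\<in>adjoin \<rat> (val f 1). x)"
  proof (rule extensionalityI[of _ "adjoin \<rat> (val f 1)"])
    show "conjugation f 1 \<in> extensional (adjoin \<rat> (val f 1))"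
      unfolding conjugation_def by (rule restrict_extensional)
  qed (simp_all only: restrict_extensional conjugation_one restrict_apply')
  finally show "conjugation f a = (\<lambda>x\<in>adjoin \<rat> (val f 1). x)" .
qed

lemma conjugation_Bij:
  assumes "coprime a N"
  shows "conjugation f a \<in> Bij (adjoin \<rat> (val f 1))"
proof -
  \<comment> \<open>Conjugation by an inverse \<open>b\<close> of \<open>a\<close> modulo
    \<open>N\<close> is the inverse map.\<close>
  obtain b where "[a * b = Suc 0] (mod N)"
    using assms coprime_iff_invertible_nat by blast
  then have ab: "a * b mod N = 1 mod N" by (simp add: cong_def)
  then have "[b * a = Suc 0] (mod N)" by (simp add: cong_def mult.commute)
  then have b: "coprime b N" using coprime_iff_invertible_nat by blast
  have inv: "conjugation f (a * b) x = x" if "x \<in> adjoin \<rat> (val f 1)" for x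
  proof -
    have "conjugation f (a * b) = conjugation f 1"
      by (subst (1 2) conjugation_mod[symmetric]) (simp only: ab)
    then show ?thesis using conjugation_one[OF that] by simp
  qed
  have "bij_betw (conjugation f a) (adjoin \<rat> (val f 1)) (adjoin \<rat> (val f 1))"
    by (rule bij_betw_byWitness[where f' = "conjugation f b"])
      (use conjugation_compose[OF assms b] conjugation_compose[OF b assms] inv
        in \<open>auto simp: mult.commute[of b]\<close>)
  moreover have "conjugation f a \<in> extensional (adjoin \<rat> (val f 1))"
    unfolding conjugation_def by (rule restrict_extensional)
  ultimately show ?thesis unfolding Bij_def by blast
qed

text \<open>An automorphism fixing the rationals commutes with rational polynomials. It therefore
  sends \<open>val f 1\<close> to another root of an irreducible polynomial vanishing there, which
  is a conjugate, and is determined by that value.\<close>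

lemma carrier_gal_group:
  "carrier (gal_group \<rat> (adjoin \<rat> (val f 1))) = conjugation f ` totatives_below"
  (is "carrier (gal_group \<rat> ?L) = _")
proof
  let ?R = "complex_ring\<lparr>carrier := ?L\<rparr>"
  show "conjugation f ` totatives_below \<subseteq> carrier (gal_group \<rat> ?L)"
  proof
    fix \<sigma> assume "\<sigma> \<in> conjugation f ` totatives_below"
    then obtain a where a: "coprime a N" "\<sigma> = conjugation f a"
      by (auto simp: totatives_below_def)
    have app: "\<sigma> (poly (map_poly of_rat g) (val f 1)) = poly (map_poly of_rat g) (val f a)" for g
      unfolding a(2) by (rule conjugation_apply[OF a(1)])
    have rat: "\<sigma> (of_rat r) = of_rat r" for r
    proof -
      have "poly (map_poly of_rat [:r:]) x = of_rat r" for x :: complex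
        by (simp add: of_rat_hom.map_poly_pCons)
      with app[of "[:r:]"] show ?thesis by (simp only:)
    qed
    have "\<sigma> \<in> ring_hom ?R ?R"
    proof (rule ring_hom_memI)
      show "\<sigma> x \<in> carrier ?R" if "x \<in> carrier ?R" for x
        using conjugation_compose(1)[OF a(1) a(1)] that by (simp add: a(2))
      fix x y assume "x \<in> carrier ?R" "y \<in> carrier ?R"
      then have "x \<in> ?L" "y \<in> ?L" by simp_all
      then obtain g h where g: "x = poly (map_poly of_rat g) (val f 1)"
        and h: "y = poly (map_poly of_rat h) (val f 1)"
        by (elim adjoin_valE)
      have "\<sigma> (x * y) = \<sigma> x * \<sigma> y"
        using app[of "g * h"] by (simp only: g h app of_rat_hom.map_poly_mult poly_mult)
      then show "\<sigma> (x \<otimes>\<^bsub>?R\<^esub> y) = \<sigma> x \<otimes>\<^bsub>?R\<^esub> \<sigma> y" by simp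
      have "\<sigma> (x + y) = \<sigma> x + \<sigma> y"
        using app[of "g + h"] by (simp only: g h app of_rat_hom.map_poly_add poly_add)
      then show "\<sigma> (x \<oplus>\<^bsub>?R\<^esub> y) = \<sigma> x \<oplus>\<^bsub>?R\<^esub> \<sigma> y" by simp
    qed (use rat[of 1] in simp)
    moreover have "\<forall>x\<in>\<rat>. \<sigma> x = x" using rat by (auto elim: Rats_cases)
    ultimately show "\<sigma> \<in> carrier (gal_group \<rat> ?L)"
      using conjugation_Bij[OF a(1)] by (simp add: gal_group_def a(2))
  qed
  show "carrier (gal_group \<rat> ?L) \<subseteq> conjugation f ` totatives_below"
  proof
    fix \<sigma> assume "\<sigma> \<in> carrier (gal_group \<rat> ?L)"
    then have ext: "\<sigma> \<in> extensional ?L" and hom: "\<sigma> \<in> ring_hom ?R ?R" and rat: "\<And>x. x \<in> \<rat> \<Longrightarrow> \<sigma> x = x"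
      by (auto simp: gal_group_def Bij_def)
    have L: "val f 1 \<in> ?L" "of_rat r \<in> ?L" for r
      using adjoin_valI[of "[:0, 1:]" f] adjoin_valI[of "[:r:]" f]
      by (simp_all add: of_rat_hom.map_poly_hom)
    have L_mult: "val f 1 * poly (map_poly of_rat g) (val f 1) \<in> ?L" for g
      using adjoin_valI[of "[:0, 1:] * g" f] by (simp add: of_rat_hom.map_poly_hom)
    have poly: "\<sigma> (poly (map_poly of_rat g) (val f 1)) = poly (map_poly of_rat g) (\<sigma> (val f 1))" for g
    proof (induction g)
      case 0
      then show ?case using rat[of 0] by simp
    next
      case (pCons c g)
      let ?x = "poly (map_poly of_rat g) (val f 1)"
      have "\<sigma> (of_rat c + val f 1 * ?x) = \<sigma> (of_rat c) + \<sigma> (val f 1 * ?x)"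
        using ring_hom_add[OF hom, of "of_rat c" "val f 1 * ?x"] L L_mult by simp
      also have "\<sigma> (val f 1 * ?x) = \<sigma> (val f 1) * \<sigma> ?x"
        using ring_hom_mult[OF hom, of "val f 1" ?x] L adjoin_valI[of g f] by simp
      also have "\<sigma> ?x = poly (map_poly of_rat g) (\<sigma> (val f 1))" by (rule pCons.IH)
      finally show ?case
        using rat[of "of_rat c"] by (simp add: of_rat_hom.map_poly_pCons)
    qed
    obtain p :: "rat poly" where p: "Factorial_Ring.irreducible p" "poly (map_poly of_rat p) (val f 1) = 0"
      using ex_rat_poly_val_root ex_irreducible_rat_poly by metis
    have "poly (map_poly of_rat p) (\<sigma> (val f 1)) = 0"
      unfolding poly[symmetric] p(2) by (rule rat) simp
    then obtain a where a: "a \<in> totatives_below" "\<sigma> (val f 1) = val f a"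
      using conjugates_exhaust_roots[OF p] by blast
    have "\<sigma> = conjugation f a"
    proof (rule extensionalityI[OF ext])
      show "conjugation f a \<in> extensional ?L" by (simp add: conjugation_def)
      fix x assume "x \<in> ?L"
      then obtain g where g: "x = poly (map_poly of_rat g) (val f 1)" by (rule adjoin_valE)
      have "coprime a N" using a(1) by (simp add: totatives_below_def)
      then show "\<sigma> x = conjugation f a x"
        unfolding g by (simp only: conjugation_apply poly a(2))
    qed
    with a show "\<sigma> \<in> conjugation f ` totatives_below" by blast
  qed
qed

lemma gal_group_iso:
  fixes f :: "rat poly"
  defines "K \<equiv> {a \<in> carrier (unit_group N). val f (nat a) = val f 1}"
  shows "K \<lhd> unit_group N"
    and "gal_group \<rat> (adjoin \<rat> (val f 1)) \<cong> unit_group N Mod K"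
proof -
  let ?U = "unit_group N" and ?L = "adjoin \<rat> (val f 1)"
  let ?h = "\<lambda>a. conjugation f (nat a)"
  note U = unit_group[OF N_pos]
  interpret U: comm_group ?U by (rule U)
  have coprime_nat: "coprime (nat a) N" if "a \<in> carrier ?U" for a
    using that by (auto simp: U(2) simp flip: coprime_int_iff)
  have carrier_U: "carrier ?U = int ` totatives_below"
  proof -
    have "a \<in> int ` totatives_below" if "a \<in> carrier ?U" for a
      using that coprime_nat[OF that]
      by (intro image_eqI[of _ _ "nat a"]) (auto simp: U(2) totatives_below_def)
    then show ?thesis by (auto simp: U(2) totatives_below_def)
  qed
  have img: "?h ` carrier ?U = carrier (gal_group \<rat> ?L)"
    by (simp only: carrier_gal_group carrier_U image_image nat_int)
  \<comment> \<open>The target is first the full group of bijections; the Galois group is then the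
    image of this homomorphism, hence a group.\<close>
  interpret h: group_hom ?U "BijGroup ?L" ?h
  proof (intro group_hom.intro group_hom_axioms.intro U.is_group group_BijGroup homI)
    show "?h a \<in> carrier (BijGroup ?L)" if "a \<in> carrier ?U" for a
      using conjugation_Bij[OF coprime_nat[OF that]] by (simp add: BijGroup_def)
    show "?h (a \<otimes>\<^bsub>?U\<^esub> b) = ?h a \<otimes>\<^bsub>BijGroup ?L\<^esub> ?h b" if ab: "a \<in> carrier ?U" "b \<in> carrier ?U" for a b
    proof -
      note cop = coprime_nat[OF ab(1)] coprime_nat[OF ab(2)]
      have "nat (a * b mod int N) = (nat a * nat b) mod N"
        using ab by (simp add: U(2) nat_mod_distrib nat_mult_distrib)
      then have "?h (a \<otimes>\<^bsub>?U\<^esub> b) = conjugation f (nat a * nat b)"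
        by (simp only: unit_group_simps conjugation_mod)
      also have "\<dots> = compose ?L (?h a) (?h b)"
      proof (rule extensionalityI[of _ ?L])
        show "conjugation f (nat a * nat b) \<in> extensional ?L"
          by (simp add: conjugation_def)
        show "conjugation f (nat a * nat b) x = compose ?L (?h a) (?h b) x" if "x \<in> ?L" for x
          using conjugation_compose(2)[OF cop that] that by (simp add: compose_def)
      qed (simp add: compose_extensional)
      also have "\<dots> = ?h a \<otimes>\<^bsub>BijGroup ?L\<^esub> ?h b"
        using conjugation_Bij cop by (simp add: BijGroup_def)
      finally show ?thesis .
    qed
  qed
  have gal: "gal_group \<rat> ?L = BijGroup ?L\<lparr>carrier := ?h ` carrier ?U\<rparr>"
    unfolding img by (simp add: gal_group_def)
  interpret g: group_hom ?U "gal_group \<rat> ?L" ?h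
  proof (intro group_hom.intro group_hom_axioms.intro U.is_group)
    show "group (gal_group \<rat> ?L)"
      unfolding gal by (intro subgroup.subgroup_is_group h.img_is_subgroup group_BijGroup)
    show "?h \<in> hom ?U (gal_group \<rat> ?L)"
      unfolding gal using h.hom_mult by (auto simp: hom_def)
  qed
  have "\<one>\<^bsub>gal_group \<rat> ?L\<^esub> = (\<lambda>x\<in>?L. x)"
    by (simp add: gal_group_def BijGroup_def)
  then have ker: "kernel ?U (gal_group \<rat> ?L) ?h = K"
    using conjugation_eq_id_iff coprime_nat by (auto simp: kernel_def K_def)
  show "K \<lhd> ?U"
    using g.normal_kernel by (simp only: ker)
  have "?U Mod K \<cong> gal_group \<rat> ?L"
    using g.FactGroup_iso[OF img] by (simp only: ker)
  then show "gal_group \<rat> ?L \<cong> ?U Mod K"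
    by (rule group.iso_sym[OF normal.factorgroup_is_group[OF \<open>K \<lhd> ?U\<close>]])
qed

end

subsection \<open>Eigenvalues of Cayley graphs\<close>

lemma primitive_root_of_unity_cis:
  assumes "N > 0"
  shows "primitive_root_of_unity N (cis (2 * pi / N))"
proof
  have bij: "bij_betw (\<lambda>k. cis (2 * pi * real k / real N)) {..<N} {z. z ^ N = 1}"
    using assms by (rule bij_betw_roots_unity)
  have power: "cis (2 * pi / N) ^ k = cis (2 * pi * real k / real N)" for k
    by (simp add: DeMoivre mult_ac)
  show "cis (2 * pi / N) ^ N = 1"
    using assms by (simp add: power)
  show "cis (2 * pi / N) ^ k \<noteq> 1" if k: "0 < k" "k < N" for k
  proof
    assume "cis (2 * pi / N) ^ k = 1"
    then have "cis (2 * pi * real k / real N) = cis (2 * pi * real 0 / real N)"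
      by (simp add: power)
    then have "k = 0"
      by (rule inj_onD[OF bij_betw_imp_inj_on[OF bij]]) (use k in simp_all)
    with k show False by simp
  qed
qed fact

lemma root_of_unity_eq_power:
  assumes "N > 0" "z ^ N = 1"
  shows "\<exists>k. z = cis (2 * pi / N) ^ k"
proof -
  have "z \<in> (\<lambda>k. cis (2 * pi * real k / real N)) ` {..<N}"
    using assms(2) by (simp add: bij_betw_imp_surj_on[OF bij_betw_roots_unity[OF assms(1)]])
  then obtain k where "z = cis (2 * pi * real k / real N)" by (rule imageE)
  then have "z = cis (2 * pi / N) ^ k" by (simp add: DeMoivre mult_ac)
  then show ?thesis ..
qed

lemma character_values:
  assumes "group G" "finite (carrier G)" "\<chi> \<in> characters G" "g \<in> carrier G"
  shows "\<chi> g ^ Coset.order G = 1" and "\<chi> (inv\<^bsub>G\<^esub> g) = inverse (\<chi> g)"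
proof -
  interpret G: group G by fact
  have Units: "\<chi> x \<in> Units complex_ring" if "x \<in> carrier G" for x
    using hom_in_carrier[OF assms(3)[unfolded characters_def] that] by (simp add: units_of_carrier)
  have mult: "\<chi> (x \<otimes>\<^bsub>G\<^esub> y) = \<chi> x * \<chi> y" if "x \<in> carrier G" "y \<in> carrier G" for x y
    using hom_mult[OF assms(3)[unfolded characters_def] that] by (simp add: units_of_mult)
  have "\<chi> \<one>\<^bsub>G\<^esub> \<noteq> 0"
    using Units[OF G.one_closed] by (auto simp: Units_def)
  \<comment> \<open>The value at the identity is idempotent and nonzero.\<close>
  with mult[of "\<one>\<^bsub>G\<^esub>" "\<one>\<^bsub>G\<^esub>"] have one: "\<chi> \<one>\<^bsub>G\<^esub> = 1" by simp
  have "\<chi> (g [^]\<^bsub>G\<^esub> n) = \<chi> g ^ n" for n :: nat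
    using assms(4) by (induction n) (simp_all add: one mult)
  from this[of "Coset.order G"] show "\<chi> g ^ Coset.order G = 1"
    using assms(2,4) by (simp add: G.pow_order_eq_1 one)
  have "\<chi> g * \<chi> (inv\<^bsub>G\<^esub> g) = 1"
    using assms(4) mult[of g "inv\<^bsub>G\<^esub> g"] by (simp add: one)
  then show "\<chi> (inv\<^bsub>G\<^esub> g) = inverse (\<chi> g)"
    by (rule inverse_unique[symmetric])
qed

theorem proposition17p1:
  fixes G :: "('g, 'b) monoid_scheme" and N :: nat and S :: "'g set"
    and \<O> :: "complex set" and \<chi> :: "'g \<Rightarrow> complex"
  defines "ev \<equiv> cayley_eigenvalue S \<chi>"
  defines "L \<equiv> adjoin \<rat> ev"
    and "U \<equiv> unit_group N"
    and "Stab \<equiv> eigenvalue_stab N S \<chi>"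
  defines "M \<equiv> generate U {(- 1) mod int N}"
  assumes "comm_group G" and "finite (carrier G)" and "Coset.order G = N"
    and "S \<subseteq> carrier G - {\<one>\<^bsub>G\<^esub>}" and "S = m_inv G ` S"
    and "\<O> \<in> galois_orbits (cayley_eigenvalue S ` characters G)"
    and "\<chi> \<in> characters G" and "ev \<in> \<O>"
  shows "galois_over_rat L
    \<and> Stab \<lhd> U
    \<and> gal_group \<rat> L \<cong> U Mod Stab
    \<and> (- 1) mod int N \<in> Stab
    \<and> M \<subseteq> Stab
    \<and> M \<lhd> U
    \<and> carrier (U\<lparr>carrier := Stab\<rparr> Mod M) \<lhd> U Mod M
    \<and> gal_group \<rat> L \<cong> (U Mod M) Mod carrier (U\<lparr>carrier := Stab\<rparr> Mod M)"
proof -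
  interpret G: comm_group G by fact
  have N: "N > 0"
    using \<open>finite (carrier G)\<close> \<open>Coset.order G = N\<close> G.order_gt_0_iff_finite by blast
  define \<zeta> where "\<zeta> = cis (2 * pi / N)"
  interpret primitive_root_of_unity N \<zeta>
    unfolding \<zeta>_def using N by (rule primitive_root_of_unity_cis)
  have S: "s \<in> carrier G" if "s \<in> S" for s
    using \<open>S \<subseteq> carrier G - {\<one>\<^bsub>G\<^esub>}\<close> that by blast
  have \<chi>_power: "\<chi> s ^ N = 1" and \<chi>_inv: "\<chi> (inv\<^bsub>G\<^esub> s) = inverse (\<chi> s)" if "s \<in> S" for s
    using character_values[OF G.is_group \<open>finite (carrier G)\<close> \<open>\<chi> \<in> characters G\<close> S[OF that]]
      \<open>Coset.order G = N\<close> by simp_all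
  have "\<forall>s\<in>S. \<exists>k. \<chi> s = \<zeta> ^ k"
    unfolding \<zeta>_def by (intro ballI root_of_unity_eq_power[OF N] \<chi>_power)
  then obtain e where e: "\<And>s. s \<in> S \<Longrightarrow> \<chi> s = \<zeta> ^ e s"
    by (rule bchoice[THEN exE]) blast
  \<comment> \<open>Collects the exponents of the character values on \<open>S\<close>, so that
    \<open>val f a\<close> is the eigenvalue belonging to the power \<open>a\<close> of
    \<open>\<chi>\<close>.\<close>
  define f :: "rat poly" where "f = (\<Sum>s\<in>S. monom 1 (e s))"
  have val_f: "val f a = cayley_eigenvalue S (char_pow \<chi> (int a))" for a
  proof -
    have "val f a = (\<Sum>s\<in>S. (\<zeta> ^ a) ^ e s)"
      unfolding f_def of_rat_hom.map_poly_sum of_rat_hom.map_poly_monom poly_sum poly_monom by simp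
    also have "\<dots> = (\<Sum>s\<in>S. \<chi> s powi int a)"
      by (intro sum.cong refl) (simp only: e power_int_of_nat mult.commute flip: power_mult)
    finally show ?thesis unfolding cayley_eigenvalue_def char_pow_def .
  qed
  have ev: "ev = val f 1"
    by (simp only: val_f) (simp add: ev_def char_pow_def cayley_eigenvalue_def)
  note U = unit_group[OF N, folded U_def]
  have Stab: "Stab = {a \<in> carrier U. val f (nat a) = val f 1}"
  proof -
    have "cayley_eigenvalue S (char_pow \<chi> a) = val f (nat a)" if "a \<in> carrier U" for a
      using that by (simp add: val_f U(2))
    moreover have "cayley_eigenvalue S \<chi> = val f 1"
      using ev by (simp only: ev_def)
    ultimately show ?thesis
      unfolding Stab_def eigenvalue_stab_def U_def[symmetric] by (intro Collect_cong conj_cong refl) simp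
  qed
  have galois: "galois_over_rat L"
    unfolding L_def ev by (rule galois_over_rat_adjoin_val)
  have Stab_normal: "Stab \<lhd> U" and iso: "gal_group \<rat> L \<cong> U Mod Stab"
    unfolding L_def ev Stab U_def by (rule gal_group_iso)+
  interpret U: comm_group U by (rule U)
  \<comment> \<open>The natural number \<open>N - 1\<close>, representing -1.\<close>
  define n where "n = nat ((- 1) mod int N)"
  have n: "int n = (- 1) mod int N" using N by (simp add: n_def)
  have minus_one_U: "(- 1) mod int N \<in> carrier U"
    using N by (simp add: U(2))
  have minus_one: "(- 1) mod int N \<in> Stab"
  proof -
    have "int N dvd int n + 1"
      unfolding n dvd_eq_mod_eq_0 mod_add_left_eq by simp
    then have "int N dvd int (n + 1)" by (simp add: add.commute)
    then have "N dvd n + 1" by (simp only: int_dvd_int_iff)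
    then obtain k where k: "n + 1 = N * k" by (rule dvdE)
    \<comment> \<open>As \<open>N\<close> divides \<open>n + 1\<close>, the power \<open>n\<close>
      inverts \<open>\<chi> s\<close>; summing over \<open>S\<close> then amounts to replacing
      \<open>S\<close> by its set of inverses, which is \<open>S\<close> again.\<close>
    have "\<chi> s ^ n = \<chi> (inv\<^bsub>G\<^esub> s)" if s: "s \<in> S" for s
    proof -
      have "\<chi> s ^ n * \<chi> s = \<chi> s ^ (n + 1)" by simp
      also have "\<dots> = 1" using \<chi>_power[OF s] by (simp only: k power_mult power_one)
      finally have "\<chi> s * \<chi> s ^ n = 1" by (simp only: mult.commute)
      then show ?thesis unfolding \<chi>_inv[OF s] by (rule inverse_unique[symmetric])
    qed
    then have "val f n = (\<Sum>s\<in>S. \<chi> (inv\<^bsub>G\<^esub> s))"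
      by (simp add: val_f cayley_eigenvalue_def char_pow_def)
    also have "\<dots> = (\<Sum>s\<in>m_inv G ` S. \<chi> s)"
      using S G.inv_inj by (subst sum.reindex) (auto simp: inj_on_def)
    also have "\<dots> = val f 1"
      unfolding \<open>S = m_inv G ` S\<close>[symmetric] ev[symmetric] ev_def cayley_eigenvalue_def ..
    finally have "val f (nat ((- 1) mod int N)) = val f 1" by (simp only: n_def)
    with minus_one_U show ?thesis unfolding Stab by blast
  qed
  have M_Stab: "M \<subseteq> Stab"
    unfolding M_def using minus_one normal_imp_subgroup[OF Stab_normal]
    by (intro U.generate_subgroup_incl) auto
  have M_normal: "M \<lhd> U"
    unfolding M_def using minus_one_U
    by (intro U.subgroup_imp_normal U.generate_is_subgroup) simp
  note third = U.third_isomorphism[OF Stab_normal M_normal M_Stab]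
  have "U Mod Stab \<cong> (U Mod M) Mod carrier (U\<lparr>carrier := Stab\<rparr> Mod M)"
    using third(2) normal.factorgroup_is_group[OF third(1)] group.iso_sym by blast
  with iso have "gal_group \<rat> L \<cong> (U Mod M) Mod carrier (U\<lparr>carrier := Stab\<rparr> Mod M)"
    by (rule iso_trans)
  with galois Stab_normal iso minus_one M_Stab M_normal third(1) show ?thesis by blast
qed

end
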